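(* Let $d\ge 1$ be an integer, let $\alpha,\beta>0$ be real numbers, and put $\theta=\alpha\beta$. Let $\mathbb{T}^2_\theta\subseteq\mathcal{B}(L^2(\mathbb{R}^d))$ be the rotation algebra, realized as the $C^*$-algebra generated by the time-frequency shifts $\{\pi(\alpha k,\beta l): k,l\in\mathbb{Z}^d\}$, and let $\mathcal{A}^\infty(\alpha,\beta)=\bigcap_{s\ge 0}\mathcal{A}^1_s(\alpha,\beta)$ be the non-commutative torus. Then $\mathcal{A}^\infty(\alpha,\beta)$ is spectral invariant in $\mathbb{T}^2_\theta$; that is, if $A\in\mathcal{A}^\infty(\alpha,\beta)$ is invertible in $\mathbb{T}^2_\theta$, then $A^{-1}\in\mathcal{A}^\infty(\alpha,\beta)$.
   Context: For $(x,\omega)\in\mathbb{R}^d\times\mathbb{R}^d$, the time-frequency shift $\pi(x,\omega)$ is the unitary operator on $L^2(\mathbb{R}^d)$ given by $\pi(x,\omega)f(t)=e^{2\pi i\omega\cdot t}f(t-x)$. For $s\ge 0$, $\ell^1_s(\mathbb{Z}^{2d})$ is the space of all complex sequences $\mathbf{a}=(a_{kl})_{k,l\in\mathbb{Z}^d}$ with $$\|\mathbf{a}\|_{1,s}=\sum_{k,l\in\mathbb{Z}^d}|a_{kl}|\,(1+\alpha^2|k|^2+\beta^2|l|^2)^{s/2}<\infty,$$ where $|\cdot|$ is the Euclidean norm on $\mathbb{R}^d$. Define $$\mathcal{A}^1_s(\alpha,\beta)=\Big\{A\in\mathcal{B}(L^2(\mathbb{R}^d)): A=\sum_{k,l\in\mathbb{Z}^d}a_{kl}\,\pi(\alpha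 k,\beta l),\ \mathbf{a}=(a_{kl})\in\ell^1_s(\mathbb{Z}^{2d})\Big\},$$ the series converging absolutely in operator norm. A subalgebra $\mathcal{A}$ of a Banach algebra $\mathcal{B}$ with common unit $I$ is called spectral invariant in $\mathcal{B}$ if $A\in\mathcal{A}$ and $A^{-1}\in\mathcal{B}$ imply $A^{-1}\in\mathcal{A}$. *)

theory Defs
  imports "HOL-Analysis.Analysis"
begin

section \<open>The Hilbert space of square-integrable functions\<close>

definition square_integrable :: "('a::euclidean_space \<Rightarrow> complex) \<Rightarrow> bool" where
  "square_integrable f \<longleftrightarrow>
     f \<in> borel_measurable lborel \<and> integrable lborel (\<lambda>t. (cmod (f t))\<^sup>2)"

lemma square_integrable_zero: "square_integrable (\<lambda>t. 0)"
  by (simp add: square_integrable_def)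

lemma square_integrable_add:
  assumes f: "square_integrable f" and g: "square_integrable g"
  shows "square_integrable (\<lambda>t. f t + g t)"
proof -
  have [measurable]: "f \<in> borel_measurable lborel" "g \<in> borel_measurable lborel"
    using f g by (auto simp: square_integrable_def)
  have bound: "(cmod (a + b))\<^sup>2 \<le> 2 * (cmod a)\<^sup>2 + 2 * (cmod b)\<^sup>2" for a b :: complex
  proof -
    have "(cmod (a + b))\<^sup>2 \<le> (cmod a + cmod b)\<^sup>2"
      by (intro power_mono norm_triangle_ineq) auto
    also have "\<dots> \<le> 2 * (cmod a)\<^sup>2 + 2 * (cmod b)\<^sup>2"
      using zero_le_power2[of "cmod a - cmod b"] by (simp add: power2_sum power2_diff)
    finally show ?thesis .
  qed
  have "integrable lborel (\<lambda>t. 2 * (cmod (f t))\<^sup>2 + 2 * (cmod (g t))\<^sup>2)"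
    using f g by (auto simp: square_integrable_def)
  then have "integrable lborel (\<lambda>t. (cmod (f t + g t))\<^sup>2)"
    by (rule Bochner_Integration.integrable_bound) (use bound in auto)
  then show ?thesis by (simp add: square_integrable_def)
qed

lemma square_integrable_cmult:
  assumes "square_integrable f"
  shows "square_integrable (\<lambda>t. c * f t)"
  using assms by (auto simp: square_integrable_def norm_mult power_mult_distrib)

lemma square_integrable_mult_cnj:
  assumes f: "square_integrable f" and g: "square_integrable g"
  shows "integrable lborel (\<lambda>t. f t * cnj (g t))"
proof -
  have [measurable]: "f \<in> borel_measurable lborel" "g \<in> borel_measurable lborel"
    using f g by (auto simp: square_integrable_def)
  have bound: "cmod a * cmod b \<le> (cmod a)\<^sup>2 + (cmod b)\<^sup>2" for a b :: complex
    using sum_squares_bound[of "cmod a" "cmod b"]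
      mult_nonneg_nonneg[OF norm_ge_zero[of a] norm_ge_zero[of b]] by linarith
  have m: "(\<lambda>t. f t * cnj (g t)) \<in> borel_measurable lborel"
    by (intro borel_measurable_times measurable_compose[OF _ borel_measurable_continuous_onI[of cnj]]
        continuous_intros) measurable
  have "integrable lborel (\<lambda>t. (cmod (f t))\<^sup>2 + (cmod (g t))\<^sup>2)"
    using f g by (auto simp: square_integrable_def)
  then show ?thesis
    by (rule Bochner_Integration.integrable_bound) (use bound m in \<open>auto simp: norm_mult\<close>)
qed

text \<open>
  Working with Borel representatives gives the same space as Lebesgue measurable ones, since every
  Lebesgue measurable function agrees almost everywhere with a Borel measurable one.
\<close>

quotient_type (overloaded) 'a L2 = "'a::euclidean_space \<Rightarrow> complex" / partial:
  "\<lambda>f g. square_integrable f \<and> square_integrable g \<and> (AE t in lborel. f t = g t)"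
proof (rule part_equivpI)
  show "\<exists>f::'a \<Rightarrow> complex. square_integrable f \<and> square_integrable f \<and> (AE t in lborel. f t = f t)"
    using square_integrable_zero by auto
qed (auto intro!: sympI transpI)

lift_definition cinner_L2 :: "'a::euclidean_space L2 \<Rightarrow> 'a L2 \<Rightarrow> complex" is
  "\<lambda>f g. integral\<^sup>L lborel (\<lambda>t. f t * cnj (g t))"
proof -
  fix f f' g g' :: "'a \<Rightarrow> complex"
  assume f: "square_integrable f \<and> square_integrable f' \<and> (AE t in lborel. f t = f' t)"
    and g: "square_integrable g \<and> square_integrable g' \<and> (AE t in lborel. g t = g' t)"
  show "integral\<^sup>L lborel (\<lambda>t. f t * cnj (g t)) = integral\<^sup>L lborel (\<lambda>t. f' t * cnj (g' t))"
  proof (rule integral_cong_AE)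
    show "AE t in lborel. f t * cnj (g t) = f' t * cnj (g' t)"
      using f g by auto
  qed (use f g in \<open>blast intro: borel_measurable_integrable square_integrable_mult_cnj\<close>)+
qed

lift_definition cscale_L2 :: "complex \<Rightarrow> 'a::euclidean_space L2 \<Rightarrow> 'a L2" is
  "\<lambda>c f t. c * f t"
  by (auto intro: square_integrable_cmult)

instantiation L2 :: (euclidean_space) real_vector
begin

lift_definition zero_L2 :: "'a L2" is "\<lambda>t. 0"
  by (simp add: square_integrable_zero)

lift_definition plus_L2 :: "'a L2 \<Rightarrow> 'a L2 \<Rightarrow> 'a L2" is "\<lambda>f g t. f t + g t"
  by (auto intro: square_integrable_add)

definition uminus_L2 :: "'a L2 \<Rightarrow> 'a L2" where "uminus_L2 f = cscale_L2 (-1) f"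

definition minus_L2 :: "'a L2 \<Rightarrow> 'a L2 \<Rightarrow> 'a L2" where "minus_L2 f g = f + (- g)"

definition scaleR_L2 :: "real \<Rightarrow> 'a L2 \<Rightarrow> 'a L2" where
  "scaleR_L2 r f = cscale_L2 (complex_of_real r) f"

instance
proof
  fix f g h :: "'a L2" and r s :: real
  show "f + g + h = f + (g + h)"
    by transfer (auto intro: square_integrable_add simp: add.assoc)
  show "f + g = g + f"
    by transfer (auto intro: square_integrable_add simp: add.commute)
  show "0 + f = f"
    by transfer auto
  show "- f + f = 0"
    unfolding uminus_L2_def by transfer (auto simp: square_integrable_zero)
  show "f - g = f + - g"
    by (simp add: minus_L2_def)
  show "r *\<^sub>R (f + g) = r *\<^sub>R f + r *\<^sub>R g"
    unfolding scaleR_L2_def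
    by transfer (auto intro!: square_integrable_add square_integrable_cmult simp: distrib_left)
  show "(r + s) *\<^sub>R f = r *\<^sub>R f + s *\<^sub>R f"
    unfolding scaleR_L2_def
    by transfer (auto intro!: square_integrable_add square_integrable_cmult
        simp flip: distrib_right)
  show "r *\<^sub>R s *\<^sub>R f = (r * s) *\<^sub>R f"
    unfolding scaleR_L2_def
    by transfer (auto intro!: square_integrable_cmult simp: mult.assoc)
  show "1 *\<^sub>R f = f"
    unfolding scaleR_L2_def by transfer auto
qed

end

lemma cscale_L2_add: "cscale_L2 c (f + g) = cscale_L2 c f + cscale_L2 c g"
  by transfer (auto intro!: square_integrable_add square_integrable_cmult simp: distrib_left)

lemma cscale_L2_cscale_L2: "cscale_L2 c (cscale_L2 c' f) = cscale_L2 (c * c') f"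
  by transfer (auto intro!: square_integrable_cmult simp: mult.assoc)

lemma cscale_L2_scaleR: "cscale_L2 c (r *\<^sub>R f) = r *\<^sub>R cscale_L2 c f"
  by (simp add: scaleR_L2_def cscale_L2_cscale_L2 mult.commute)

lemma cinner_L2_commute: "cinner_L2 g f = cnj (cinner_L2 f g)"
  by transfer (simp flip: Bochner_Integration.integral_cnj add: mult.commute)

lemma cinner_L2_add_left: "cinner_L2 (f + g) h = cinner_L2 f h + cinner_L2 g h"
  by transfer (auto simp: distrib_right square_integrable_mult_cnj)

lemma cinner_L2_cscale_left: "cinner_L2 (cscale_L2 c f) g = c * cinner_L2 f g"
  by transfer (simp add: mult.assoc)

lemma cinner_L2_self:
  "cinner_L2 f f = complex_of_real (Re (cinner_L2 f f))" "0 \<le> Re (cinner_L2 f f)"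
  "cinner_L2 f f = 0 \<longleftrightarrow> f = 0"
proof -
  show "cinner_L2 f f = complex_of_real (Re (cinner_L2 f f))"
    using cinner_L2_commute[of f f] by (simp add: complex_eq_iff)
  have eq: "integral\<^sup>L lborel (\<lambda>t. f t * cnj (f t)) =
      complex_of_real (integral\<^sup>L lborel (\<lambda>t. (cmod (f t))\<^sup>2))" for f :: "'a \<Rightarrow> complex"
    by (simp only: complex_norm_square[symmetric] integral_complex_of_real)
  show "0 \<le> Re (cinner_L2 f f)"
    by transfer (simp add: eq)
  show "cinner_L2 f f = 0 \<longleftrightarrow> f = 0"
  proof transfer
    fix f :: "'a \<Rightarrow> complex"
    assume "square_integrable f \<and> square_integrable f \<and> (AE t in lborel. f t = f t)"
    then show "(integral\<^sup>L lborel (\<lambda>t. f t * cnj (f t)) = 0) =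
      (square_integrable f \<and> square_integrable (\<lambda>t::'a. 0) \<and> (AE t in lborel. f t = 0))"
      using integral_nonneg_eq_0_iff_AE[of lborel "\<lambda>t. (cmod (f t))\<^sup>2"]
      by (simp add: eq square_integrable_def)
  qed
qed

text \<open>The real inner product is the real part of the complex one; both induce the same norm.\<close>

instantiation L2 :: (euclidean_space) real_inner
begin

definition inner_L2 :: "'a L2 \<Rightarrow> 'a L2 \<Rightarrow> real" where
  "inner_L2 f g = Re (cinner_L2 f g)"

definition norm_L2 :: "'a L2 \<Rightarrow> real" where
  "norm_L2 f = sqrt (inner f f)"

definition sgn_L2 :: "'a L2 \<Rightarrow> 'a L2" where
  "sgn_L2 f = f /\<^sub>R norm f"

definition dist_L2 :: "'a L2 \<Rightarrow> 'a L2 \<Rightarrow> real" where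
  "dist_L2 f g = norm (f - g)"

definition uniformity_L2 :: "('a L2 \<times> 'a L2) filter" where
  "uniformity_L2 = (INF e\<in>{0 <..}. principal {(x, y). dist x y < e})"

definition open_L2 :: "'a L2 set \<Rightarrow> bool" where
  "open_L2 U \<longleftrightarrow> (\<forall>x\<in>U. eventually (\<lambda>(x', y). x' = x \<longrightarrow> y \<in> U) uniformity)"

instance
proof
  fix f g h :: "'a L2" and r :: real and U :: "'a L2 set"
  show "inner f g = inner g f"
    using cinner_L2_commute[of f g] by (simp add: inner_L2_def)
  show "inner (f + g) h = inner f h + inner g h"
    by (simp add: inner_L2_def cinner_L2_add_left)
  show "inner (r *\<^sub>R f) g = r * inner f g"
    by (simp add: inner_L2_def scaleR_L2_def cinner_L2_cscale_left)
  show "0 \<le> inner f f"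
    by (simp add: inner_L2_def cinner_L2_self(2))
  show "inner f f = 0 \<longleftrightarrow> f = 0"
    unfolding inner_L2_def using cinner_L2_self(1,3)[of f] by (metis of_real_eq_0_iff)
qed (auto simp: norm_L2_def sgn_L2_def dist_L2_def uniformity_L2_def open_L2_def)

end

lemma norm_cscale_L2: "norm (cscale_L2 c f) = cmod c * norm f"
proof -
  have "cinner_L2 (cscale_L2 c f) (cscale_L2 c f) = c * cnj c * cinner_L2 f f"
    by (simp add: cinner_L2_cscale_left cinner_L2_commute[of f "cscale_L2 c f"]
        flip: cinner_L2_commute[of f f])
  then have "Re (cinner_L2 (cscale_L2 c f) (cscale_L2 c f)) = (cmod c)\<^sup>2 * Re (cinner_L2 f f)"
    by (simp flip: complex_norm_square)
  then show ?thesis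
    by (simp add: norm_L2_def inner_L2_def real_sqrt_mult)
qed


section \<open>Bounded operators\<close>

text \<open>
  The library type of bounded linear maps is real-linear; bounded operators on the complex
  Hilbert space are singled out by complex homogeneity.
\<close>

type_synonym 'a L2_op = "'a L2 \<Rightarrow>\<^sub>L 'a L2"

definition bounded_ops :: "'a::euclidean_space L2_op set" where
  "bounded_ops = {A. \<forall>c f. blinfun_apply A (cscale_L2 c f) = cscale_L2 c (blinfun_apply A f)}"

lemma bounded_linear_cscale_L2: "bounded_linear (cscale_L2 c)"
  by (rule bounded_linear_intro[where K = "cmod c"])
    (simp_all add: cscale_L2_add cscale_L2_scaleR norm_cscale_L2 mult.commute)

definition cscale_op :: "complex \<Rightarrow> 'a::euclidean_space L2_op \<Rightarrow> 'a L2_op" where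
  "cscale_op c A = Blinfun (\<lambda>f. cscale_L2 c (blinfun_apply A f))"

lemma cscale_op_apply: "blinfun_apply (cscale_op c A) f = cscale_L2 c (blinfun_apply A f)"
proof -
  have "bounded_linear (\<lambda>f. cscale_L2 c (blinfun_apply A f))"
    by (rule bounded_linear_compose[OF bounded_linear_cscale_L2 blinfun.bounded_linear_right])
  then show ?thesis
    by (simp add: cscale_op_def bounded_linear_Blinfun_apply)
qed

definition is_adjoint :: "'a::euclidean_space L2_op \<Rightarrow> 'a L2_op \<Rightarrow> bool" where
  "is_adjoint A B \<longleftrightarrow>
     (\<forall>f g. cinner_L2 (blinfun_apply A f) g = cinner_L2 f (blinfun_apply B g))"

definition subalgebra :: "'a::euclidean_space L2_op set \<Rightarrow> bool" where
  "subalgebra S \<longleftrightarrow> S \<subseteq> bounded_ops \<and> 0 \<in> S \<and>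
     (\<forall>A\<in>S. \<forall>B\<in>S. A + B \<in> S) \<and> (\<forall>c. \<forall>A\<in>S. cscale_op c A \<in> S) \<and>
     (\<forall>A\<in>S. \<forall>B\<in>S. A o\<^sub>L B \<in> S)"

definition banach_subalgebra :: "'a::euclidean_space L2_op set \<Rightarrow> bool" where
  "banach_subalgebra S \<longleftrightarrow> subalgebra S \<and> complete S"

text \<open>
  Adjoints are unique, so demanding that some adjoint lies in \<open>S\<close> is closure under the involution.
\<close>

definition cstar_subalgebra :: "'a::euclidean_space L2_op set \<Rightarrow> bool" where
  "cstar_subalgebra S \<longleftrightarrow> subalgebra S \<and> closed S \<and> (\<forall>A\<in>S. \<exists>B\<in>S. is_adjoint A B)"

definition cstar_generated :: "'a::euclidean_space L2_op set \<Rightarrow> 'a L2_op set" where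
  "cstar_generated G = \<Inter>{S. cstar_subalgebra S \<and> G \<subseteq> S}"

text \<open>
  That \<open>\<A>\<close> is a subalgebra of the Banach algebra \<open>\<B>\<close> with common unit is part of the notion.
\<close>

definition spectral_invariant ::
  "'a::euclidean_space L2_op set \<Rightarrow> 'a L2_op set \<Rightarrow> bool" where
  "spectral_invariant \<A> \<B> \<longleftrightarrow>
     subalgebra \<A> \<and> banach_subalgebra \<B> \<and> \<A> \<subseteq> \<B> \<and>
     id_blinfun \<in> \<A> \<and> id_blinfun \<in> \<B> \<and>
     (\<forall>A\<in>\<A>. \<forall>B\<in>\<B>. A o\<^sub>L B = id_blinfun \<and> B o\<^sub>L A = id_blinfun \<longrightarrow> B \<in> \<A>)"


section \<open>Time-frequency shifts and the non-commutative torus\<close>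

lemma lborel_translate: "distr lborel borel (\<lambda>t. t - x) = (lborel :: 'a::euclidean_space measure)"
  using lborel_affine[of 1 "- x"] by (simp add: density_1)

lemma integrable_translate:
  fixes g :: "'a::euclidean_space \<Rightarrow> real"
  assumes "integrable lborel g"
  shows "integrable lborel (\<lambda>t. g (t - x))"
proof (rule integrable_distr[where M' = borel and T = "\<lambda>t. t - x"])
  show "(\<lambda>t. t - x) \<in> measurable lborel borel"
    by measurable
  show "integrable (distr lborel borel (\<lambda>t. t - x)) g"
    using assms by (simp add: lborel_translate)
qed

lemma integral_translate:
  fixes g :: "'a::euclidean_space \<Rightarrow> complex"
  assumes [measurable]: "g \<in> borel_measurable lborel"
  shows "integral\<^sup>L lborel (\<lambda>t. g (t - x)) = integral\<^sup>L lborel g"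
proof -
  have "integral\<^sup>L lborel g = integral\<^sup>L (distr lborel borel (\<lambda>t. t - x)) g"
    by (simp add: lborel_translate)
  also have "\<dots> = integral\<^sup>L lborel (\<lambda>t. g (t - x))"
    by (rule integral_distr) (use assms in auto)
  finally show ?thesis ..
qed

lemma AE_translate:
  assumes "AE t in (lborel :: 'a::euclidean_space measure). P t"
  shows "AE t in lborel. P (t - x)"
proof -
  have "AE t in distr lborel borel (\<lambda>t::'a. t - x). P t"
    by (subst lborel_translate) (rule assms)
  then show ?thesis
    by (rule AE_distrD[rotated]) simp
qed

lemma square_integrable_tf_shift:
  fixes f :: "'a::euclidean_space \<Rightarrow> complex"
  assumes f: "square_integrable f"
  shows "square_integrable (\<lambda>t. exp (2 * complex_of_real pi * \<i> * complex_of_real (\<omega> \<bullet> t)) * f (t - x))"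
proof -
  let ?e = "\<lambda>t. exp (2 * complex_of_real pi * \<i> * complex_of_real (\<omega> \<bullet> t))"
  have [measurable]: "f \<in> borel_measurable borel"
    using f by (simp add: square_integrable_def)
  have "integrable lborel (\<lambda>t. (cmod (f (t - x)))\<^sup>2)"
    using f integrable_translate[of "\<lambda>t. (cmod (f t))\<^sup>2" x] by (simp add: square_integrable_def)
  moreover have "(\<lambda>t. ?e t * f (t - x)) \<in> borel_measurable borel"
  proof (rule borel_measurable_times)
    show "?e \<in> borel_measurable borel"
      by (intro borel_measurable_continuous_onI continuous_intros)
  qed measurable
  ultimately show ?thesis
    by (simp add: square_integrable_def norm_mult)
qed

lift_definition tf_shift_L2 :: "'a::euclidean_space \<Rightarrow> 'a \<Rightarrow> 'a L2 \<Rightarrow> 'a L2" is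
  "\<lambda>x \<omega> f t. exp (2 * complex_of_real pi * \<i> * complex_of_real (\<omega> \<bullet> t)) * f (t - x)"
  by (elim conjE, intro conjI square_integrable_tf_shift)
    (assumption | erule AE_translate[THEN eventually_mono] | simp)+

lemma tf_shift_L2_add: "tf_shift_L2 x \<omega> (f + g) = tf_shift_L2 x \<omega> f + tf_shift_L2 x \<omega> g"
  by transfer (simp add: square_integrable_add square_integrable_tf_shift distrib_left)

lemma tf_shift_L2_cscale: "tf_shift_L2 x \<omega> (cscale_L2 c f) = cscale_L2 c (tf_shift_L2 x \<omega> f)"
  by transfer (simp add: square_integrable_cmult square_integrable_tf_shift mult.left_commute)

lemma cinner_tf_shift_L2: "cinner_L2 (tf_shift_L2 x \<omega> f) (tf_shift_L2 x \<omega> g) = cinner_L2 f g"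
proof transfer
  fix x \<omega> :: 'a and f g :: "'a \<Rightarrow> complex"
  let ?e = "\<lambda>t. exp (2 * complex_of_real pi * \<i> * complex_of_real (\<omega> \<bullet> t))"
  assume "square_integrable f \<and> square_integrable f \<and> (AE t in lborel. f t = f t)"
    and "square_integrable g \<and> square_integrable g \<and> (AE t in lborel. g t = g t)"
  then have "(\<lambda>t. f t * cnj (g t)) \<in> borel_measurable lborel"
    using borel_measurable_integrable square_integrable_mult_cnj by blast
  moreover have "?e t * f (t - x) * cnj (?e t * g (t - x)) = f (t - x) * cnj (g (t - x))" for t
  proof -
    have "?e t * f (t - x) * cnj (?e t * g (t - x)) = (?e t * cnj (?e t)) * (f (t - x) * cnj (g (t - x)))"
      by (simp only: complex_cnj_mult mult.assoc mult.left_commute)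
    also have "?e t * cnj (?e t) = 1"
      by (simp add: complex_norm_square[symmetric])
    finally show ?thesis by simp
  qed
  ultimately show "integral\<^sup>L lborel (\<lambda>t. ?e t * f (t - x) * cnj (?e t * g (t - x))) =
      integral\<^sup>L lborel (\<lambda>t. f t * cnj (g t))"
    using integral_translate[of "\<lambda>t. f t * cnj (g t)" x] by (simp only:)
qed

lemma norm_tf_shift_L2: "norm (tf_shift_L2 x \<omega> f) = norm f"
  by (simp only: norm_L2_def inner_L2_def cinner_tf_shift_L2)

lemma bounded_linear_tf_shift_L2: "bounded_linear (tf_shift_L2 x \<omega>)"
proof (rule bounded_linear_intro[where K = 1])
  show "tf_shift_L2 x \<omega> (r *\<^sub>R f) = r *\<^sub>R tf_shift_L2 x \<omega> f" for r f
    by (simp only: scaleR_L2_def tf_shift_L2_cscale)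
qed (simp_all only: tf_shift_L2_add norm_tf_shift_L2 mult_1_right order_refl)

definition tf_shift :: "'a::euclidean_space \<Rightarrow> 'a \<Rightarrow> 'a L2_op" where
  "tf_shift x \<omega> = Blinfun (tf_shift_L2 x \<omega>)"

lemma tf_shift_apply: "blinfun_apply (tf_shift x \<omega>) f = tf_shift_L2 x \<omega> f"
  by (simp add: tf_shift_def bounded_linear_Blinfun_apply bounded_linear_tf_shift_L2)

definition real_vec :: "int ^ 'd \<Rightarrow> real ^ 'd" where
  "real_vec k = (\<chi> i. real_of_int (k $ i))"

definition weighted_l1 ::
  "real \<Rightarrow> real \<Rightarrow> real \<Rightarrow> (int ^ 'd \<Rightarrow> int ^ 'd \<Rightarrow> complex) set" where
  "weighted_l1 s \<alpha> \<beta> =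
     {a. (\<lambda>(k, l). cmod (a k l) *
            (1 + \<alpha>\<^sup>2 * (norm (real_vec k))\<^sup>2 + \<beta>\<^sup>2 * (norm (real_vec l))\<^sup>2) powr (s / 2))
         summable_on UNIV}"

text \<open>
  \<open>has_sum\<close> on operators is convergence in operator norm over finite subsets of the index set;
  it is absolute here because the shifts are unitary and the weights are at least \<open>1\<close> for \<open>s \<ge> 0\<close>.
\<close>

definition tf_algebra :: "real \<Rightarrow> real \<Rightarrow> real \<Rightarrow> (real ^ 'd) L2_op set" where
  "tf_algebra s \<alpha> \<beta> =
     {A \<in> bounded_ops. \<exists>a \<in> weighted_l1 s \<alpha> \<beta>.
        ((\<lambda>(k, l). cscale_op (a k l) (tf_shift (\<alpha> *\<^sub>R real_vec k) (\<beta> *\<^sub>R real_vec l)))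
          has_sum A) UNIV}"

definition noncommutative_torus :: "real \<Rightarrow> real \<Rightarrow> (real ^ 'd) L2_op set" where
  "noncommutative_torus \<alpha> \<beta> = (\<Inter>s\<in>{0..}. tf_algebra s \<alpha> \<beta>)"

definition rotation_algebra :: "real \<Rightarrow> real \<Rightarrow> (real ^ 'd) L2_op set" where
  "rotation_algebra \<alpha> \<beta> =
     cstar_generated (range (\<lambda>(k, l). tf_shift (\<alpha> *\<^sub>R real_vec k) (\<beta> *\<^sub>R real_vec l)))"

end

theory Submission
  imports Defs
begin

text \<open>
  The proof is elementary: it uses neither the smooth torus action nor Fourier series. If \<open>A\<close> is
  invertible, \<open>R = 1 - l A\<^sup>* A\<close> has operator norm \<open>< 1\<close> for a small \<open>l > 0\<close>, and
  \<open>A\<inverse> = l (\<Sum>n. R ^ n) A\<^sup>*\<close>. Multiplying the coefficients by a power of a lattice coordinate is a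
  power of a derivation of the twisted convolution algebra, so by the Leibniz rule the operator norms
  of the moments of \<open>R ^ n\<close> decay geometrically in \<open>n\<close>. Averaging conjugates of an absolutely
  convergent sum over powers of a suitable time-frequency shift isolates single coefficients, which are
  therefore bounded by the operator norm; hence the coefficients of \<open>R ^ n\<close> decay geometrically in
  \<open>n\<close> and polynomially, to any order, in the lattice point, and the Neumann series converges in
  every weighted norm.
\<close>

section \<open>Completeness of L2\<close>

text \<open>The operator norm dominates the supremum of the coefficients, not their sum. Passing
  from one to the other costs additional powers of the lattice coordinates, enough to beat a
  summable function on Z^(2d). A bound on the inverse in weight s therefore consumes moments of A of
  higher order than s, and the argument fits the intersection over all s. The adjoint enters because
  an arbitrary invertible A need not be near the identity, even after rescaling, while 1 - l A' A,
  with A' the adjoint, is a strict contraction for small l. The Leibniz recursion produces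
  polynomial factors in n; they are absorbed by a rate strictly between the norm of R and 1.
  Conjugating by lattice shifts alone would not isolate coefficients: for rational \<theta> the
  resulting phases are roots of unity, and for integral \<theta> the lattice shifts commute. The
  averaging hence uses shifts off the lattice, chosen to rotate one coordinate by an irrational
  angle. Completeness of L2 is settled at the start because it makes the operator space a Banach
  space, where absolutely convergent sums have limits.\<close>

lemma norm_abs_L2:
  assumes "square_integrable f"
  shows "ennreal ((norm (abs_L2 f))\<^sup>2) = (\<integral>\<^sup>+ t. ennreal ((cmod (f t))\<^sup>2) \<partial>lborel)"
proof -
  have eq: "integral\<^sup>L lborel (\<lambda>t. f t * cnj (f t)) =
      complex_of_real (integral\<^sup>L lborel (\<lambda>t. (cmod (f t))\<^sup>2))"
    by (simp only: complex_norm_square[symmetric] integral_complex_of_real)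
  have "(norm (abs_L2 f))\<^sup>2 = Re (cinner_L2 (abs_L2 f) (abs_L2 f))"
    by (simp add: norm_L2_def inner_L2_def cinner_L2_self(2))
  also have "\<dots> = integral\<^sup>L lborel (\<lambda>t. (cmod (f t))\<^sup>2)"
    using assms by (simp add: cinner_L2.abs_eq eq)
  finally show ?thesis
    using assms by (simp add: square_integrable_def nn_integral_eq_integral)
qed

lemma square_integrable_diff:
  assumes "square_integrable f" "square_integrable g"
  shows "square_integrable (\<lambda>t. f t - g t)"
  using square_integrable_add[OF assms(1) square_integrable_cmult[OF assms(2), of "- 1"]] by simp

lemma abs_L2_diff:
  assumes "square_integrable f" "square_integrable g"
  shows "abs_L2 f - abs_L2 g = abs_L2 (\<lambda>t. f t - g t)"
  using assms square_integrable_cmult[OF assms(2), of "- 1"]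
  by (simp add: minus_L2_def uminus_L2_def cscale_L2.abs_eq plus_L2.abs_eq)

lemma square_integrableI:
  assumes [measurable]: "f \<in> borel_measurable lborel"
    and "(\<integral>\<^sup>+ t. ennreal ((cmod (f t))\<^sup>2) \<partial>lborel) < \<infinity>"
  shows "square_integrable f"
  using assms(2) unfolding square_integrable_def
  by (auto intro!: integrableI_bounded)

lemma ex_square_integrable_rep:
  fixes X :: "'a::euclidean_space L2"
  shows "\<exists>f. square_integrable f \<and> X = abs_L2 f"
  by (induct X rule: L2.abs_induct) auto

lemma summable_geometric_factor:
  fixes g :: "nat \<Rightarrow> real"
  assumes nn: "\<And>n. 0 \<le> g n" and s: "summable (\<lambda>n. 2 ^ n * (g n)\<^sup>2)"
  shows "summable g"
proof (rule summable_comparison_test')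
  show "summable (\<lambda>n. 2 ^ n * (g n)\<^sup>2 + (1 / 2) ^ n)"
    using s by (intro summable_add summable_geometric) auto
  show "norm (g n) \<le> 2 ^ n * (g n)\<^sup>2 + (1 / 2) ^ n" for n
  proof -
    \<comment> \<open>Expanding this square and dividing by \<open>2 ^ n\<close> is the
      arithmetic-geometric inequality
      \<open>2 * g n \<le> 2 ^ n * (g n)\<^sup>2 + (1 / 2) ^ n\<close>.\<close>
    have "0 \<le> (2 ^ n * g n - 1)\<^sup>2" by simp
    then have "2 * 2 ^ n * g n \<le> 2 ^ n * (2 ^ n * (g n)\<^sup>2) + 1"
      by (simp add: power2_diff power_mult_distrib power2_eq_square algebra_simps)
    moreover have "2 ^ n * (2 ^ n * (g n)\<^sup>2 + (1 / 2) ^ n) = 2 ^ n * (2 ^ n * (g n)\<^sup>2) + 1"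
      by (simp add: distrib_left power_one_over)
    ultimately have "2 ^ n * (2 * g n) \<le> 2 ^ n * (2 ^ n * (g n)\<^sup>2 + (1 / 2) ^ n)"
      by (simp add: mult_ac)
    then have "2 * g n \<le> 2 ^ n * (g n)\<^sup>2 + (1 / 2) ^ n"
      by (subst (asm) mult_le_cancel_left_pos) auto
    then show ?thesis using nn[of n] by simp
  qed
qed

lemma rapid_Cauchy_subseq:
  fixes X :: "nat \<Rightarrow> 'a::metric_space" and e :: "nat \<Rightarrow> real"
  assumes "Cauchy X" and e: "\<And>n. 0 < e n"
  obtains r where "strict_mono r" "\<And>n m. n \<le> m \<Longrightarrow> dist (X (r m)) (X (r n)) < e n"
proof -
  have "\<exists>N. \<forall>n. \<forall>m\<ge>N n. \<forall>k\<ge>N n. dist (X m) (X k) < e n"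
    using assms unfolding Cauchy_def by (intro choice) blast
  then obtain N where N: "\<And>n m k. N n \<le> m \<Longrightarrow> N n \<le> k \<Longrightarrow> dist (X m) (X k) < e n"
    by blast
  \<comment> \<open>Partial sums dominate each \<open>N n\<close>, and the summand 1 makes them
    strictly increasing.\<close>
  define r where "r n = (\<Sum>i\<le>n. N i + 1)" for n
  have r: "strict_mono r"
    by (auto simp: strict_mono_Suc_iff r_def)
  have "N n \<le> r n" for n
    unfolding r_def by (cases n) auto
  moreover have "r n \<le> r m" if "n \<le> m" for n m
    using r that by (simp add: strict_mono_less_eq)
  ultimately show ?thesis
    by (intro that[OF r] N) (blast intro: order_trans)+
qed

text \<open>Riesz--Fischer: the weights \<open>2 ^ n\<close> make the square-summed increments of a rapidly
  converging subsequence integrable, hence the subsequence converges almost everywhere; Fatou's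
  lemma identifies the norm limit.\<close>

lemma L2_Cauchy_convergent:
  fixes X :: "nat \<Rightarrow> 'a::euclidean_space L2"
  assumes "Cauchy X"
  shows "convergent X"
proof -
  obtain r where r: "strict_mono r"
    and rapid: "\<And>n m. n \<le> m \<Longrightarrow> dist (X (r m)) (X (r n)) < (1 / 2) ^ n"
    using rapid_Cauchy_subseq[OF assms, of "\<lambda>n. (1 / 2) ^ n"] by auto
  have "\<exists>f. \<forall>n. square_integrable (f n) \<and> X (r n) = abs_L2 (f n)"
    by (intro choice allI ex_square_integrable_rep)
  then obtain f where f: "\<And>n. square_integrable (f n)" and Xf: "\<And>n. X (r n) = abs_L2 (f n)"
    by blast
  have [measurable]: "f n \<in> borel_measurable lborel" for n
    using f by (simp add: square_integrable_def)
  have close: "(\<integral>\<^sup>+ t. ennreal ((cmod (f m t - f n t))\<^sup>2) \<partial>lborel) \<le> ennreal (((1 / 2) ^ n)\<^sup>2)"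
    if "n \<le> m" for n m
  proof -
    have "norm (abs_L2 (\<lambda>t. f m t - f n t)) \<le> (1 / 2) ^ n"
      using rapid[OF that] by (simp add: dist_norm Xf abs_L2_diff f)
    then show ?thesis
      by (auto simp flip: norm_abs_L2[OF square_integrable_diff[OF f[of m] f[of n]]]
          intro!: ennreal_leI power_mono)
  qed
  define d where "d n t = (cmod (f (Suc n) t - f n t))" for n t
  have [measurable]: "d n \<in> borel_measurable lborel" for n
    unfolding d_def by measurable
  have "(\<integral>\<^sup>+ t. (\<Sum>n. ennreal (2 ^ n * (d n t)\<^sup>2)) \<partial>lborel) =
      (\<Sum>n. \<integral>\<^sup>+ t. ennreal (2 ^ n * (d n t)\<^sup>2) \<partial>lborel)"
    by (rule nn_integral_suminf) measurable
  also have "\<dots> \<le> (\<Sum>n. ennreal ((1 / 2) ^ n))"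
  proof (intro suminf_le)
    fix n
    have "(\<integral>\<^sup>+ t. ennreal (2 ^ n * (d n t)\<^sup>2) \<partial>lborel) =
        ennreal (2 ^ n) * (\<integral>\<^sup>+ t. ennreal ((d n t)\<^sup>2) \<partial>lborel)"
      by (subst nn_integral_cmult[symmetric]) (auto simp: ennreal_mult)
    also have "\<dots> \<le> ennreal (2 ^ n) * ennreal (((1 / 2) ^ n)\<^sup>2)"
      unfolding d_def by (intro mult_left_mono close) auto
    also have "\<dots> = ennreal ((1 / 2) ^ n)"
      by (simp add: ennreal_mult[symmetric] power2_eq_square power_one_over)
    finally show "(\<integral>\<^sup>+ t. ennreal (2 ^ n * (d n t)\<^sup>2) \<partial>lborel) \<le> ennreal ((1 / 2) ^ n)" .
  qed auto
  also have "\<dots> = ennreal (\<Sum>n. (1 / 2) ^ n)"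
    by (intro suminf_ennreal2 summable_geometric) auto
  also have "\<dots> < \<infinity>" by simp
  finally have "(\<integral>\<^sup>+ t. (\<Sum>n. ennreal (2 ^ n * (d n t)\<^sup>2)) \<partial>lborel) \<noteq> \<infinity>" by simp
  then have "AE t in lborel. (\<Sum>n. ennreal (2 ^ n * (d n t)\<^sup>2)) \<noteq> \<infinity>"
    by (rule nn_integral_PInf_AE[rotated]) measurable
  then have AE_conv: "AE t in lborel. (\<lambda>n. f n t) \<longlonglongrightarrow> lim (\<lambda>n. f n t)"
  proof (rule eventually_mono)
    fix t assume "(\<Sum>n. ennreal (2 ^ n * (d n t)\<^sup>2)) \<noteq> \<infinity>"
    then have "summable (\<lambda>n. 2 ^ n * (d n t)\<^sup>2)"
      by (intro summable_suminf_not_top) auto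
    then have "summable (\<lambda>n. d n t)"
      by (rule summable_geometric_factor[rotated]) (simp add: d_def)
    then have "summable (\<lambda>n. f (Suc n) t - f n t)"
      unfolding d_def by (rule summable_norm_cancel)
    then have "convergent (\<lambda>n. \<Sum>i<n. f (Suc i) t - f i t)"
      by (simp add: summable_iff_convergent)
    then have "convergent (\<lambda>n. f n t - f 0 t)"
      by (simp add: sum_lessThan_telescope[of "\<lambda>i. f i t"])
    then have "convergent (\<lambda>n. f n t)"
      using convergent_add[OF _ convergent_const[of "f 0 t"]] by fastforce
    then show "(\<lambda>n. f n t) \<longlonglongrightarrow> lim (\<lambda>n. f n t)"
      by (rule convergent_LIMSEQ_iff[THEN iffD1])
  qed
  \<comment> \<open>On the null set of divergence \<open>lim\<close> has an unspecified value;
    measurability survives and the integrals ignore that set.\<close>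
  define F where "F t = lim (\<lambda>n. f n t)" for t
  have [measurable]: "F \<in> borel_measurable lborel"
    unfolding F_def by measurable
  have limit: "(\<integral>\<^sup>+ t. ennreal ((cmod (F t - f n t))\<^sup>2) \<partial>lborel) \<le> ennreal (((1 / 2) ^ n)\<^sup>2)" for n
  proof -
    have "(\<integral>\<^sup>+ t. ennreal ((cmod (F t - f n t))\<^sup>2) \<partial>lborel) =
        (\<integral>\<^sup>+ t. liminf (\<lambda>m. ennreal ((cmod (f m t - f n t))\<^sup>2)) \<partial>lborel)"
    proof (intro nn_integral_cong_AE eventually_mono[OF AE_conv])
      fix t assume "(\<lambda>n. f n t) \<longlonglongrightarrow> lim (\<lambda>n. f n t)"
      then have "(\<lambda>m. ennreal ((cmod (f m t - f n t))\<^sup>2)) \<longlonglongrightarrow> ennreal ((cmod (F t - f n t))\<^sup>2)"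
        unfolding F_def by (intro tendsto_intros tendsto_ennrealI) 
      then show "ennreal ((cmod (F t - f n t))\<^sup>2) = liminf (\<lambda>m. ennreal ((cmod (f m t - f n t))\<^sup>2))"
        by (intro lim_imp_Liminf[symmetric]) simp_all
    qed
    also have "\<dots> \<le> liminf (\<lambda>m. \<integral>\<^sup>+ t. ennreal ((cmod (f m t - f n t))\<^sup>2) \<partial>lborel)"
      by (rule nn_integral_liminf) measurable
    also have "\<dots> \<le> ennreal (((1 / 2) ^ n)\<^sup>2)"
    proof -
      have "liminf (\<lambda>m. \<integral>\<^sup>+ t. ennreal ((cmod (f m t - f n t))\<^sup>2) \<partial>lborel) \<le>
          limsup (\<lambda>m. \<integral>\<^sup>+ t. ennreal ((cmod (f m t - f n t))\<^sup>2) \<partial>lborel)"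
        by (rule Liminf_le_Limsup) simp
      also have "\<dots> \<le> ennreal (((1 / 2) ^ n)\<^sup>2)"
        by (rule Limsup_bounded) (intro eventually_mono[OF eventually_ge_at_top[of n]] close)
      finally show ?thesis .
    qed
    finally show ?thesis .
  qed
  have Ff: "square_integrable (\<lambda>t. F t - f n t)" for n
    by (rule square_integrableI) (use limit[of n] in \<open>auto intro: le_less_trans\<close>)
  have F: "square_integrable F"
    using square_integrable_add[OF Ff[of 0] f[of 0]] by simp
  have "norm (X (r n) - abs_L2 F) \<le> (1 / 2) ^ n" for n
  proof -
    have "ennreal ((norm (abs_L2 (\<lambda>t. F t - f n t)))\<^sup>2) \<le> ennreal (((1 / 2) ^ n)\<^sup>2)"
      using limit[of n] by (simp only: norm_abs_L2[OF Ff])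
    then have "(norm (abs_L2 (\<lambda>t. F t - f n t)))\<^sup>2 \<le> ((1 / 2) ^ n)\<^sup>2"
      by (subst (asm) ennreal_le_iff) simp_all
    then have "norm (abs_L2 (\<lambda>t. F t - f n t)) \<le> (1 / 2) ^ n"
      by (rule power2_le_imp_le) simp
    then show ?thesis
      by (subst norm_minus_commute) (simp only: Xf abs_L2_diff[OF F f])
  qed
  moreover have "(\<lambda>n. (1 / 2 :: real) ^ n) \<longlonglongrightarrow> 0"
    by (rule LIMSEQ_power_zero) simp
  ultimately have "(\<lambda>n. X (r n) - abs_L2 F) \<longlonglongrightarrow> 0"
    by (rule Lim_null_comparison[OF always_eventually[OF allI]])
  then have "(X \<circ> r) \<longlonglongrightarrow> abs_L2 F"
    unfolding o_def by (rule LIM_zero_cancel)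
  then show ?thesis
    using Cauchy_converges_subseq[OF assms r] convergentI by blast
qed

text \<open>With this instance the operator space is complete as well: absolute summability of
  operators gives convergence, and Cauchy sequences of adjoints have limits.\<close>

instance L2 :: (euclidean_space) banach
  by standard (rule L2_Cauchy_convergent)

section \<open>Operators and adjoints\<close>

lemma cscale_L2_of_real: "cscale_L2 (complex_of_real r) f = r *\<^sub>R f"
  by (simp add: scaleR_L2_def)

lemma cscale_L2_add_left: "cscale_L2 (c + d) f = cscale_L2 c f + cscale_L2 d f"
  by transfer (auto intro!: square_integrable_add square_integrable_cmult simp: distrib_right)

lemma bounded_bilinear_cscale_op:
  "bounded_bilinear (cscale_op :: complex \<Rightarrow> 'a::euclidean_space L2_op \<Rightarrow> 'a L2_op)"
proof
  fix c d :: complex and r :: real and A B :: "'a L2_op"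
  show "cscale_op (c + d) A = cscale_op c A + cscale_op d A"
    by (rule blinfun_eqI) (simp add: cscale_op_apply blinfun.add_left cscale_L2_add_left)
  show "cscale_op c (A + B) = cscale_op c A + cscale_op c B"
    by (rule blinfun_eqI) (simp add: cscale_op_apply blinfun.add_left cscale_L2_add)
  show "cscale_op (r *\<^sub>R c) A = r *\<^sub>R cscale_op c A"
    by (rule blinfun_eqI)
      (simp add: cscale_op_apply blinfun.scaleR_left scaleR_L2_def cscale_L2_cscale_L2 scaleR_conv_of_real)
  show "cscale_op c (r *\<^sub>R A) = r *\<^sub>R cscale_op c A"
    by (rule blinfun_eqI) (simp add: cscale_op_apply blinfun.scaleR_left cscale_L2_scaleR)
  have "norm (cscale_op c A) \<le> norm c * norm A" for c and A :: "'a L2_op"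
    by (rule norm_blinfun_bound)
      (auto simp: cscale_op_apply norm_cscale_L2 mult.assoc intro!: mult_left_mono norm_blinfun)
  then show "\<exists>K. \<forall>c (A :: 'a L2_op). norm (cscale_op c A) \<le> norm c * norm A * K"
    by (intro exI[of _ 1]) simp
qed

interpretation cscale_op: bounded_bilinear cscale_op
  by (rule bounded_bilinear_cscale_op)

lemma norm_cscale_op: "norm (cscale_op c A) \<le> cmod c * norm A"
  by (rule norm_blinfun_bound)
    (auto simp: cscale_op_apply norm_cscale_L2 mult.assoc intro!: mult_left_mono norm_blinfun)

lemma cscale_op_cscale_op: "cscale_op c (cscale_op d A) = cscale_op (c * d) A"
  by (rule blinfun_eqI) (simp add: cscale_op_apply cscale_L2_cscale_L2)

lemma cscale_op_of_real: "cscale_op (complex_of_real r) A = r *\<^sub>R A"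
  by (rule blinfun_eqI) (simp add: cscale_op_apply cscale_L2_of_real blinfun.scaleR_left)

lemma cscale_op_1 [simp]: "cscale_op 1 A = A"
  using cscale_op_of_real[of 1 A] by simp

lemma cscale_op_compose_left: "cscale_op c A o\<^sub>L B = cscale_op c (A o\<^sub>L B)"
  by (rule blinfun_eqI) (simp add: cscale_op_apply)

lemma cscale_op_compose_right: "A \<in> bounded_ops \<Longrightarrow> A o\<^sub>L cscale_op c B = cscale_op c (A o\<^sub>L B)"
  by (rule blinfun_eqI) (simp add: cscale_op_apply bounded_ops_def)

lemma blinfun_compose_id [simp]: "id_blinfun o\<^sub>L A = A" "A o\<^sub>L id_blinfun = A"
  by (auto intro: blinfun_eqI)

lemma subalgebra_bounded_ops: "subalgebra bounded_ops"
  by (auto simp: subalgebra_def bounded_ops_def blinfun.add_left cscale_L2_add cscale_op_apply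
      cscale_L2_cscale_L2 mult.commute linear_0[OF bounded_linear.linear[OF bounded_linear_cscale_L2]])

lemma tf_shift_in_bounded_ops [simp]: "tf_shift x \<omega> \<in> bounded_ops"
  by (simp add: bounded_ops_def tf_shift_apply tf_shift_L2_cscale)

lemma norm_tf_shift: "norm (tf_shift x \<omega>) \<le> 1"
  by (rule norm_blinfun_bound) (simp_all add: tf_shift_apply norm_tf_shift_L2)

lemma closed_bounded_ops: "closed (bounded_ops :: 'a::euclidean_space L2_op set)"
proof -
  have eq: "bounded_ops = (\<Inter>c. \<Inter>f. {A :: 'a L2_op. A (cscale_L2 c f) = cscale_L2 c (A f)})"
    by (auto simp: bounded_ops_def)
  show ?thesis
    unfolding eq
    by (intro closed_INT ballI closed_Collect_eq continuous_intros
        bounded_linear.continuous_on[OF bounded_linear_cscale_L2])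
qed

lemma cinner_L2_add_right: "cinner_L2 f (g + h) = cinner_L2 f g + cinner_L2 f h"
  by (metis cinner_L2_add_left cinner_L2_commute complex_cnj_add)

lemma cinner_L2_cscale_right: "cinner_L2 f (cscale_L2 c g) = cnj c * cinner_L2 f g"
  by (metis cinner_L2_cscale_left cinner_L2_commute complex_cnj_mult)

lemma bounded_bilinear_cinner_L2:
  "bounded_bilinear (cinner_L2 :: 'a::euclidean_space L2 \<Rightarrow> 'a L2 \<Rightarrow> complex)"
proof
  fix f g h :: "'a L2" and r :: real
  show "cinner_L2 (f + g) h = cinner_L2 f h + cinner_L2 g h"
    by (rule cinner_L2_add_left)
  show "cinner_L2 f (g + h) = cinner_L2 f g + cinner_L2 f h"
    by (rule cinner_L2_add_right)
  show "cinner_L2 (r *\<^sub>R f) g = r *\<^sub>R cinner_L2 f g"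
    by (simp add: scaleR_L2_def cinner_L2_cscale_left scaleR_conv_of_real)
  show "cinner_L2 f (r *\<^sub>R g) = r *\<^sub>R cinner_L2 f g"
    by (simp add: scaleR_L2_def cinner_L2_cscale_right scaleR_conv_of_real)
  have "cmod (cinner_L2 f g) \<le> norm f * norm g * 2" for f g :: "'a L2"
  proof -
    \<comment> \<open>Since Re(-i z) = Im z, the real Cauchy-Schwarz inequality bounds the imaginary
      part too; adding both bounds gives the crude factor 2, which suffices for continuity.\<close>
    have "Im (cinner_L2 f g) = inner (cscale_L2 (- \<i>) f) g"
      by (simp add: inner_L2_def cinner_L2_cscale_left)
    then have "\<bar>Im (cinner_L2 f g)\<bar> \<le> norm f * norm g"
      using Cauchy_Schwarz_ineq2[of "cscale_L2 (- \<i>) f" g] by (simp add: norm_cscale_L2)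
    moreover have "\<bar>Re (cinner_L2 f g)\<bar> \<le> norm f * norm g"
      using Cauchy_Schwarz_ineq2[of f g] by (simp add: inner_L2_def)
    ultimately show ?thesis
      using cmod_le[of "cinner_L2 f g"] by simp
  qed
  then show "\<exists>K. \<forall>(f :: 'a L2) g. norm (cinner_L2 f g) \<le> norm f * norm g * K"
    by blast
qed

interpretation cinner_L2: bounded_bilinear cinner_L2
  by (rule bounded_bilinear_cinner_L2)

lemma is_adjoint_sym: "is_adjoint A B \<Longrightarrow> is_adjoint B A"
  unfolding is_adjoint_def by (metis cinner_L2_commute)

lemma is_adjoint_add: "is_adjoint A B \<Longrightarrow> is_adjoint C D \<Longrightarrow> is_adjoint (A + C) (B + D)"
  by (simp add: is_adjoint_def blinfun.add_left cinner_L2.add_left cinner_L2.add_right)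

lemma is_adjoint_diff: "is_adjoint A B \<Longrightarrow> is_adjoint C D \<Longrightarrow> is_adjoint (A - C) (B - D)"
  by (simp add: is_adjoint_def blinfun.diff_left cinner_L2.diff_left cinner_L2.diff_right)

lemma is_adjoint_cscale: "is_adjoint A B \<Longrightarrow> is_adjoint (cscale_op c A) (cscale_op (cnj c) B)"
  by (simp add: is_adjoint_def cscale_op_apply cinner_L2_cscale_left cinner_L2_cscale_right)

lemma is_adjoint_compose: "is_adjoint A B \<Longrightarrow> is_adjoint C D \<Longrightarrow> is_adjoint (A o\<^sub>L C) (D o\<^sub>L B)"
  by (simp add: is_adjoint_def)

lemma is_adjoint_0: "is_adjoint 0 0"
  by (simp add: is_adjoint_def cinner_L2.zero_left cinner_L2.zero_right)

lemma is_adjoint_sum: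
  "(\<And>i. i \<in> I \<Longrightarrow> is_adjoint (A i) (B i)) \<Longrightarrow> is_adjoint (sum A I) (sum B I)"
  by (induct I rule: infinite_finite_induct) (auto simp: is_adjoint_0 is_adjoint_add)

lemma is_adjoint_lim:
  assumes A: "(A \<longlongrightarrow> A') F" and B: "(B \<longlongrightarrow> B') F" and "F \<noteq> bot"
    and adj: "\<And>n. is_adjoint (A n) (B n)"
  shows "is_adjoint A' B'"
  unfolding is_adjoint_def
proof (intro allI)
  fix f g
  have "((\<lambda>n. cinner_L2 (A n f) g) \<longlongrightarrow> cinner_L2 (A' f) g) F"
    by (intro cinner_L2.tendsto blinfun.tendsto A tendsto_const)
  moreover have "((\<lambda>n. cinner_L2 f (B n g)) \<longlongrightarrow> cinner_L2 f (B' g)) F"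
    by (intro cinner_L2.tendsto blinfun.tendsto B tendsto_const)
  moreover have "cinner_L2 (A n f) g = cinner_L2 f (B n g)" for n
    using adj by (simp add: is_adjoint_def)
  ultimately show "cinner_L2 (A' f) g = cinner_L2 f (B' g)"
    using tendsto_unique[OF \<open>F \<noteq> bot\<close>] by simp
qed

lemma is_adjoint_inner: "is_adjoint A B \<Longrightarrow> inner (A f) g = inner f (B g)"
  by (simp add: is_adjoint_def inner_L2_def)

text \<open>Apply the adjoint relation to the vector \<open>B g\<close> itself and cancel one factor
  \<open>norm (B g)\<close>. Applied to differences, this makes the adjoints of a convergent
  sequence a Cauchy sequence.\<close>

lemma norm_is_adjoint_le:
  assumes "is_adjoint A B"
  shows "norm B \<le> norm A"
proof (rule norm_blinfun_bound)
  fix g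
  have "norm (B g) * norm (B g) = inner (A (B g)) g"
    using is_adjoint_inner[OF assms, of "B g" g] by (simp add: dot_square_norm power2_eq_square)
  also have "\<dots> \<le> norm (A (B g)) * norm g"
    by (rule norm_cauchy_schwarz)
  also have "\<dots> \<le> norm A * norm (B g) * norm g"
    by (intro mult_right_mono norm_blinfun) auto
  finally have "norm (B g) * norm (B g) \<le> norm (B g) * (norm A * norm g)"
    by (simp add: mult_ac)
  then show "norm (B g) \<le> norm A * norm g"
    by (cases "norm (B g) = 0") (auto simp: mult_le_cancel_left)
qed simp

text \<open>Existence of adjoints is built in here, which avoids the Riesz representation theorem.\<close>

lemma cstar_subalgebra_adjointable:
  "cstar_subalgebra {A \<in> bounded_ops :: 'a::euclidean_space L2_op set. \<exists>B \<in> bounded_ops. is_adjoint A B}"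
    (is "cstar_subalgebra ?S")
proof -
  have ops: "A + B \<in> bounded_ops" "cscale_op c A \<in> bounded_ops" "A o\<^sub>L B \<in> bounded_ops"
    if "A \<in> bounded_ops" "B \<in> bounded_ops" for A B :: "'a L2_op" and c
    using subalgebra_bounded_ops that unfolding subalgebra_def by auto
  have zero: "(0 :: 'a L2_op) \<in> bounded_ops"
    using subalgebra_bounded_ops unfolding subalgebra_def by auto
  have "subalgebra ?S"
    unfolding subalgebra_def
  proof (intro conjI ballI allI)
    show "?S \<subseteq> bounded_ops" "0 \<in> ?S"
      using zero is_adjoint_0 by auto
  next
    fix A B :: "'a L2_op" assume "A \<in> ?S" "B \<in> ?S"
    then obtain A' B' where *: "A \<in> bounded_ops" "B \<in> bounded_ops" "A' \<in> bounded_ops" "B' \<in> bounded_ops"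
      "is_adjoint A A'" "is_adjoint B B'" by blast
    show "A + B \<in> ?S"
      by (intro CollectI conjI bexI[of _ "A' + B'"] is_adjoint_add ops(1) *)
    show "A o\<^sub>L B \<in> ?S"
      by (intro CollectI conjI bexI[of _ "B' o\<^sub>L A'"] is_adjoint_compose ops(3) *)
    show "cscale_op c A \<in> ?S" for c
      by (intro CollectI conjI bexI[of _ "cscale_op (cnj c) A'"] is_adjoint_cscale ops(2)[OF *(1,1)] ops(2)[OF *(3,3)] *)
  qed
  moreover have "closed ?S"
    unfolding closed_sequential_limits
  proof (intro allI impI, elim conjE)
    fix X L assume X: "\<forall>n. X n \<in> ?S" and lim: "X \<longlonglongrightarrow> L"
    have "\<exists>Y. \<forall>n. Y n \<in> bounded_ops \<and> is_adjoint (X n) (Y n)"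
      by (intro choice) (use X in blast)
    then obtain Y where Y: "\<And>n. Y n \<in> bounded_ops" "\<And>n. is_adjoint (X n) (Y n)"
      by blast
    have "dist (Y m) (Y n) \<le> dist (X m) (X n)" for m n
      unfolding dist_norm by (intro norm_is_adjoint_le is_adjoint_diff Y)
    then have "Cauchy Y"
      using LIMSEQ_imp_Cauchy[OF lim] unfolding Cauchy_def by (meson le_less_trans)
    then obtain M where M: "Y \<longlonglongrightarrow> M"
      by (auto simp: Cauchy_convergent_iff convergent_def)
    have "is_adjoint L M"
      by (rule is_adjoint_lim[OF lim M]) (auto simp: Y)
    moreover have "L \<in> bounded_ops" "M \<in> bounded_ops"
      using closed_bounded_ops lim M X Y(1) by (auto simp: closed_sequential_limits)
    ultimately show "L \<in> ?S" by blast
  qed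
  ultimately show ?thesis
    unfolding cstar_subalgebra_def using is_adjoint_sym by blast
qed

text \<open>The hypothesis supplies one C*-subalgebra containing \<open>G\<close>. An intersection
  over an empty family would be the whole type, including operators that are only
  real-linear.\<close>

lemma cstar_generated:
  assumes "G \<subseteq> {A \<in> bounded_ops. \<exists>B \<in> bounded_ops. is_adjoint A B}"
  shows "subalgebra (cstar_generated G)" "closed (cstar_generated G)" "G \<subseteq> cstar_generated G"
proof -
  have "cstar_generated G \<subseteq> bounded_ops"
    unfolding cstar_generated_def using cstar_subalgebra_adjointable assms by blast
  then show "subalgebra (cstar_generated G)"
    unfolding subalgebra_def cstar_generated_def cstar_subalgebra_def by simp
  show "closed (cstar_generated G)"
    unfolding cstar_generated_def cstar_subalgebra_def by (intro closed_Inter) blast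
  show "G \<subseteq> cstar_generated G"
    unfolding cstar_generated_def by auto
qed

section \<open>Composition and adjoints of time-frequency shifts\<close>

lemma tf_shift_L2_tf_shift_L2:
  "tf_shift_L2 x \<omega> (tf_shift_L2 y \<eta> f) =
     cscale_L2 (exp (- (2 * complex_of_real pi * \<i> * complex_of_real (\<eta> \<bullet> x)))) (tf_shift_L2 (x + y) (\<omega> + \<eta>) f)"
proof transfer
  fix x \<omega> y \<eta> :: 'a and f :: "'a \<Rightarrow> complex"
  let ?e = "\<lambda>\<omega> t. exp (2 * complex_of_real pi * \<i> * complex_of_real (\<omega> \<bullet> t))"
  assume "square_integrable f \<and> square_integrable f \<and> (AE t in lborel. f t = f t)"
  then have f: "square_integrable f" by simp
  have eq: "?e \<omega> t * (?e \<eta> (t - x) * f (t - x - y)) =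
     exp (- (2 * complex_of_real pi * \<i> * complex_of_real (\<eta> \<bullet> x))) * (?e (\<omega> + \<eta>) t * f (t - (x + y)))" for t
  proof -
    \<comment> \<open>The inner modulation is evaluated at the translated point
      \<open>t - x\<close>; splitting its exponent leaves a phase independent of
      \<open>t\<close>.\<close>
    have "2 * complex_of_real pi * \<i> * complex_of_real (\<omega> \<bullet> t) +
        2 * complex_of_real pi * \<i> * complex_of_real (\<eta> \<bullet> (t - x)) =
        - (2 * complex_of_real pi * \<i> * complex_of_real (\<eta> \<bullet> x)) +
        2 * complex_of_real pi * \<i> * complex_of_real ((\<omega> + \<eta>) \<bullet> t)"
      by (simp add: inner_diff_right inner_add_left ring_distribs)
    then show ?thesis
      by (simp only: diff_diff_eq mult.assoc[symmetric] exp_add[symmetric])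
  qed
  show "square_integrable (\<lambda>t. ?e \<omega> t * (?e \<eta> (t - x) * f (t - x - y))) \<and>
     square_integrable (\<lambda>t. exp (- (2 * complex_of_real pi * \<i> * complex_of_real (\<eta> \<bullet> x))) * (?e (\<omega> + \<eta>) t * f (t - (x + y)))) \<and>
     (AE t in lborel. ?e \<omega> t * (?e \<eta> (t - x) * f (t - x - y)) =
     exp (- (2 * complex_of_real pi * \<i> * complex_of_real (\<eta> \<bullet> x))) * (?e (\<omega> + \<eta>) t * f (t - (x + y))))"
    unfolding eq by (auto intro!: square_integrable_cmult square_integrable_tf_shift f)
qed

lemma tf_shift_compose:
  "tf_shift x \<omega> o\<^sub>L tf_shift y \<eta> =
     cscale_op (exp (- (2 * complex_of_real pi * \<i> * complex_of_real (\<eta> \<bullet> x)))) (tf_shift (x + y) (\<omega> + \<eta>))"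
  by (rule blinfun_eqI) (simp add: tf_shift_apply cscale_op_apply tf_shift_L2_tf_shift_L2)

lemma tf_shift_0: "tf_shift 0 0 = id_blinfun"
proof (rule blinfun_eqI)
  have "tf_shift_L2 0 0 f = f" for f :: "'a L2"
    by transfer simp
  then show "blinfun_apply (tf_shift 0 0) f = blinfun_apply id_blinfun f" for f :: "'a L2"
    by (simp add: tf_shift_apply)
qed

text \<open>A right inverse of an operator preserving the inner product is its adjoint. The scalar
  cancels the phase that arises when the shift is composed with
  \<open>tf_shift (- x) (- \<omega>)\<close>.\<close>

lemma is_adjoint_tf_shift:
  "is_adjoint (tf_shift x \<omega>)
     (cscale_op (exp (- (2 * complex_of_real pi * \<i> * complex_of_real (\<omega> \<bullet> x)))) (tf_shift (- x) (- \<omega>)))"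
  unfolding is_adjoint_def
proof (intro allI)
  fix f g
  let ?B = "cscale_op (exp (- (2 * complex_of_real pi * \<i> * complex_of_real (\<omega> \<bullet> x)))) (tf_shift (- x) (- \<omega>))"
  have "tf_shift x \<omega> o\<^sub>L ?B = id_blinfun"
    by (simp add: cscale_op_compose_right tf_shift_compose cscale_op_cscale_op tf_shift_0 mult_exp_exp)
  then have "g = tf_shift_L2 x \<omega> (?B g)"
    by (metis blinfun_apply_blinfun_compose blinfun_apply_id_blinfun tf_shift_apply)
  then show "cinner_L2 (tf_shift x \<omega> f) g = cinner_L2 f (?B g)"
    by (metis cinner_tf_shift_L2 tf_shift_apply)
qed

section \<open>Absolutely convergent sums of a projective representation\<close>

text \<open>An arbitrary weight is allowed so that one set of lemmas covers the unweighted space,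
  the weights of the theorem and the coordinate-degree weights used for moments.\<close>

definition wl1 :: "('g \<Rightarrow> real) \<Rightarrow> ('g \<Rightarrow> complex) set" where
  "wl1 w = {a. (\<lambda>z. cmod (a z) * w z) summable_on UNIV}"

abbreviation l1 :: "('g \<Rightarrow> complex) set" where "l1 \<equiv> wl1 (\<lambda>_. 1)"

lemma wl1_comparison:
  assumes "b \<in> wl1 w'" and le: "\<And>z. cmod (a z) * w z \<le> C * (cmod (b z) * w' z)" and "\<And>z. 0 \<le> w z"
  shows "a \<in> wl1 w"
proof -
  have "(\<lambda>z. C * (cmod (b z) * w' z)) summable_on UNIV"
    using assms(1) unfolding wl1_def by (auto intro: summable_on_cmult_right)
  then show ?thesis
    unfolding wl1_def using assms by (auto intro: summable_on_comparison_test)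
qed

lemma wl1_mono:
  assumes "a \<in> wl1 w'" "\<And>z. 0 \<le> w z" "\<And>z. w z \<le> C * w' z"
  shows "a \<in> wl1 w"
proof (rule wl1_comparison[OF assms(1)])
  show "cmod (a z) * w z \<le> C * (cmod (a z) * w' z)" for z
    using mult_left_mono[OF assms(3), of "cmod (a z)" z] by (simp add: mult_ac)
qed (use assms in auto)

lemma wl1_add:
  assumes "a \<in> wl1 w" "b \<in> wl1 w" and w: "\<And>z. 0 \<le> w z"
  shows "(\<lambda>z. a z + b z) \<in> wl1 w"
proof -
  have "(\<lambda>z. cmod (a z) * w z + cmod (b z) * w z) summable_on UNIV"
    using assms unfolding wl1_def by (auto intro: summable_on_add)
  then show ?thesis
    unfolding wl1_def mem_Collect_eq
    by (rule summable_on_comparison_test)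
      (auto simp: w distrib_right[symmetric] intro!: mult_right_mono norm_triangle_ineq)
qed

lemma wl1_cmult:
  assumes "a \<in> wl1 w"
  shows "(\<lambda>z. c * a z) \<in> wl1 w"
  using assms unfolding wl1_def by (auto simp: norm_mult mult.assoc intro: summable_on_cmult_right)

lemma wl1_delta: "(\<lambda>z. if z = z0 then c else 0) \<in> wl1 w"
proof -
  have "(\<lambda>z. cmod (if z = z0 then c else 0) * w z) summable_on UNIV \<longleftrightarrow>
     (\<lambda>z. cmod (if z = z0 then c else 0) * w z) summable_on {z0}"
    by (rule summable_on_cong_neutral) auto
  then show ?thesis
    unfolding wl1_def by simp
qed

lemma summable_on_product:
  fixes f g :: "'b \<Rightarrow> real"
  assumes "f summable_on UNIV" "g summable_on UNIV" "\<And>x. 0 \<le> f x" "\<And>y. 0 \<le> g y"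
  shows "(\<lambda>(x, y). f x * g y) summable_on UNIV \<times> UNIV"
proof (rule summable_on_SigmaI[where g = "\<lambda>x. f x * infsum g UNIV"])
  show "((\<lambda>y. case (x, y) of (x, y) \<Rightarrow> f x * g y) has_sum f x * infsum g UNIV) UNIV" for x
    using has_sum_cmult_right[OF has_sum_infsum[OF assms(2)]] by simp
  show "(\<lambda>x. f x * infsum g UNIV) summable_on UNIV"
    using assms by (intro summable_on_cmult_left)
qed (use assms in auto)

text \<open>A projective unitary representation of an abelian group: \<open>\<kappa>\<close> is its
  multiplier and \<open>\<eta>\<close> the phase relating the adjoint of \<open>u z\<close> to
  \<open>u (- z)\<close>. In the application the group is the lattice Z^(2d).\<close>

locale twisted_rep =
  fixes u :: "'g::ab_group_add \<Rightarrow> 'a::euclidean_space L2_op"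
    and \<kappa> :: "'g \<Rightarrow> 'g \<Rightarrow> complex" and \<eta> :: "'g \<Rightarrow> complex"
  assumes u_ops: "u z \<in> bounded_ops" and norm_u: "norm (u z) \<le> 1"
    and u_0: "u 0 = id_blinfun"
    and u_mult: "u y o\<^sub>L u z = cscale_op (\<kappa> y z) (u (y + z))" and norm_\<kappa>: "cmod (\<kappa> y z) = 1"
    and u_adjoint: "is_adjoint (u z) (cscale_op (\<eta> z) (u (- z)))" and norm_\<eta>: "cmod (\<eta> z) = 1"
begin

definition op :: "('g \<Rightarrow> complex) \<Rightarrow> 'a L2_op" where
  "op a = (\<Sum>\<^sub>\<infinity>z. cscale_op (a z) (u z))"

text \<open>Twisted convolution: collecting the coefficient of \<open>u z\<close> in the formal
  product of two series gives this sum.\<close>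

definition conv :: "('g \<Rightarrow> complex) \<Rightarrow> ('g \<Rightarrow> complex) \<Rightarrow> 'g \<Rightarrow> complex" where
  "conv a b z = (\<Sum>\<^sub>\<infinity>y. a y * b (z - y) * \<kappa> y (z - y))"

text \<open>The multiple of \<open>u z\<close> in the adjoint series comes from the term at
  \<open>- z\<close>, whose adjoint carries the phase \<open>\<eta> (- z)\<close>.\<close>

definition star :: "('g \<Rightarrow> complex) \<Rightarrow> 'g \<Rightarrow> complex" where
  "star a z = cnj (a (- z)) * \<eta> (- z)"

lemma norm_cscale_u: "norm (cscale_op c (u z)) \<le> cmod c"
  by (rule order_trans[OF norm_cscale_op]) (simp add: mult_left_le norm_u)

lemma l1_abs_summable:
  assumes "a \<in> l1"
  shows "(\<lambda>z. norm (cscale_op (a z) (u z))) summable_on UNIV"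
  by (rule Infinite_Sum.abs_summable_on_comparison_test'[where g = "\<lambda>z. cmod (a z)"])
    (use assms in \<open>auto simp: wl1_def norm_cscale_u\<close>)

lemma has_sum_op:
  assumes "a \<in> l1"
  shows "((\<lambda>z. cscale_op (a z) (u z)) has_sum op a) UNIV"
  unfolding op_def by (rule has_sum_infsum[OF abs_summable_summable[OF l1_abs_summable[OF assms]]])

lemma op_eqI: "((\<lambda>z. cscale_op (a z) (u z)) has_sum A) UNIV \<Longrightarrow> op a = A"
  unfolding op_def by (rule infsumI)

lemma norm_op_le:
  assumes "a \<in> l1"
  shows "norm (op a) \<le> (\<Sum>\<^sub>\<infinity>z. cmod (a z))"
proof (rule norm_infsum_le[OF has_sum_op[OF assms]])
  show "((\<lambda>z. cmod (a z)) has_sum (\<Sum>\<^sub>\<infinity>z. cmod (a z))) UNIV"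
    using assms by (intro has_sum_infsum) (simp add: wl1_def)
qed (rule norm_cscale_u)

lemma op_in_closed_subalgebra:
  assumes "a \<in> l1" and S: "subalgebra S" "closed S" "range u \<subseteq> S"
  shows "op a \<in> S"
proof -
  have u: "cscale_op (a z) (u z) \<in> S" for z
    using S unfolding subalgebra_def by (simp add: range_subsetD)
  have "sum (\<lambda>z. cscale_op (a z) (u z)) F \<in> S" for F
    using S(1) unfolding subalgebra_def by (induct F rule: infinite_finite_induct) (simp_all add: u)
  moreover have "(sum (\<lambda>z. cscale_op (a z) (u z)) \<longlongrightarrow> op a) (finite_subsets_at_top UNIV)"
    using has_sum_op[OF assms(1)] by (simp add: has_sum_def)
  ultimately show ?thesis
    by (intro Lim_in_closed_set[OF S(2)]) auto
qed

lemma op_in_bounded_ops: "a \<in> l1 \<Longrightarrow> op a \<in> bounded_ops"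
  by (rule op_in_closed_subalgebra[OF _ subalgebra_bounded_ops closed_bounded_ops]) (auto simp: u_ops)

lemma op_add:
  assumes "a \<in> l1" "b \<in> l1"
  shows "op (\<lambda>z. a z + b z) = op a + op b"
  by (rule op_eqI) (simp add: cscale_op.add_left has_sum_add has_sum_op assms)

lemma op_cmult:
  assumes "a \<in> l1"
  shows "op (\<lambda>z. c * a z) = cscale_op c (op a)"
  by (rule op_eqI)
    (simp add: has_sum_bounded_linear[OF cscale_op.bounded_linear_right has_sum_op[OF assms]]
      flip: cscale_op_cscale_op)

lemma op_delta: "op (\<lambda>z. if z = z0 then c else 0) = cscale_op c (u z0)"
proof (rule op_eqI)
  have "((\<lambda>z. cscale_op (if z = z0 then c else 0) (u z)) has_sum cscale_op c (u z0)) {z0}"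
    by (rule has_sum_finiteI) auto
  then show "((\<lambda>z. cscale_op (if z = z0 then c else 0) (u z)) has_sum cscale_op c (u z0)) UNIV"
    by (rule has_sum_cong_neutral[THEN iffD1, rotated -1]) (auto simp: cscale_op.zero_left)
qed

text \<open>The bijection sending (y, x) to (y + x, y) turns the family into a product of two
  weighted summable ones, up to the factor \<open>K\<close>. This is the Fubini hypothesis behind
  every statement about \<open>conv\<close>; the factor is kept because the lattice weights are
  submultiplicative only up to a constant.\<close>

lemma conv_pair_summable:
  fixes a b :: "'g \<Rightarrow> complex"
  assumes a: "a \<in> wl1 w" and b: "b \<in> wl1 w" and w: "\<And>z. 0 \<le> w z"
    and submult: "\<And>y z. w (y + z) \<le> K * w y * w z"
  shows "(\<lambda>(z, y). cmod (a y) * cmod (b (z - y)) * w z) summable_on UNIV \<times> UNIV"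
proof -
  have "(\<lambda>(y, x). (cmod (a y) * w y) * (cmod (b x) * w x)) summable_on UNIV \<times> UNIV"
    using a b w by (intro summable_on_product) (auto simp: wl1_def)
  then have "(\<lambda>p. K * (case p of (y, x) \<Rightarrow> (cmod (a y) * w y) * (cmod (b x) * w x))) summable_on UNIV \<times> UNIV"
    by (rule summable_on_cmult_right)
  then have *: "(\<lambda>(y, x). cmod (a y) * cmod (b x) * w (y + x)) summable_on UNIV \<times> UNIV"
  proof (rule summable_on_comparison_test)
    show "(case p of (y, x) \<Rightarrow> cmod (a y) * cmod (b x) * w (y + x)) \<le>
        K * (case p of (y, x) \<Rightarrow> (cmod (a y) * w y) * (cmod (b x) * w x))" for p
      using mult_left_mono[OF submult, of "cmod (a (fst p)) * cmod (b (snd p))" "fst p" "snd p"]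
      by (simp add: case_prod_unfold mult_ac)
  qed (auto simp: w)
  show ?thesis
    by (rule summable_on_reindex_bij_witness[where S = "UNIV \<times> UNIV" and T = "UNIV \<times> UNIV"
          and j = "\<lambda>(y :: 'g, x :: 'g). (y + x, y)" and i = "\<lambda>(z :: 'g, y :: 'g). (y, z - y)", THEN iffD1, OF _ _ _ _ _ *])
      auto
qed

lemma conv_wl1:
  assumes a: "a \<in> wl1 w" and b: "b \<in> wl1 w" and w: "\<And>z. 0 \<le> w z"
    and submult: "\<And>y z. w (y + z) \<le> K * w y * w z"
  shows "conv a b \<in> wl1 w"
proof -
  let ?f = "\<lambda>(z, y). a y * b (z - y) * \<kappa> y (z - y) * complex_of_real (w z)"
  have "(\<lambda>p. norm (?f p)) summable_on UNIV \<times> UNIV"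
    using conv_pair_summable[OF assms] by (simp add: case_prod_unfold norm_mult norm_\<kappa> w)
  then have f: "\<And>z. (\<lambda>y. norm (?f (z, y))) summable_on UNIV"
    and F: "(\<lambda>z. norm (infsum (\<lambda>y. norm (?f (z, y))) UNIV)) summable_on UNIV"
    using Infinite_Sum.abs_summable_on_Sigma_iff[of ?f UNIV "\<lambda>_. UNIV"] by blast+
  have "cmod (conv a b z) * w z \<le> norm (infsum (\<lambda>y. norm (?f (z, y))) UNIV)" for z
  proof -
    have "conv a b z * complex_of_real (w z) = infsum (\<lambda>y. ?f (z, y)) UNIV"
      unfolding conv_def by (simp add: infsum_cmult_left')
    then have "cmod (conv a b z) * w z = norm (infsum (\<lambda>y. ?f (z, y)) UNIV)"
      using w[of z] by (metis abs_of_nonneg norm_mult norm_of_real)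
    also have "\<dots> \<le> infsum (\<lambda>y. norm (?f (z, y))) UNIV"
      by (rule norm_infsum_bound[OF f])
    finally show ?thesis by simp
  qed
  then show ?thesis
    unfolding wl1_def mem_Collect_eq
    by (intro summable_on_comparison_test[OF F]) (auto simp: w)
qed

lemma conv_l1: "a \<in> l1 \<Longrightarrow> b \<in> l1 \<Longrightarrow> conv a b \<in> l1"
  by (rule conv_wl1[where K = 1]) auto

lemma conv_has_sum:
  assumes "a \<in> l1" "b \<in> l1"
  shows "((\<lambda>y. a y * b (z - y) * \<kappa> y (z - y)) has_sum conv a b z) UNIV"
proof -
  let ?f = "\<lambda>(z, y). a y * b (z - y) * \<kappa> y (z - y)"
  have "(\<lambda>p. norm (?f p)) summable_on UNIV \<times> UNIV"
    using conv_pair_summable[OF assms, of 1] by (simp add: case_prod_unfold norm_mult norm_\<kappa>)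
  then have "(\<lambda>y. norm (?f (z, y))) summable_on UNIV"
    using Infinite_Sum.abs_summable_on_Sigma_iff[of ?f UNIV "\<lambda>_. UNIV"] by blast
  then have "(\<lambda>y. ?f (z, y)) summable_on UNIV"
    by (rule abs_summable_summable)
  then show ?thesis
    unfolding conv_def by (simp add: has_sum_infsum)
qed

text \<open>Both sides are iterated sums of one absolutely convergent double family: summing over
  \<open>y\<close> for fixed \<open>z = y + x\<close> gives the left side, and summing over
  \<open>x\<close> for fixed \<open>y\<close> gives the right.\<close>

lemma op_conv:
  assumes a: "a \<in> l1" and b: "b \<in> l1"
  shows "op (conv a b) = op a o\<^sub>L op b"
proof -
  let ?h = "\<lambda>(z, y). cscale_op (a y * b (z - y) * \<kappa> y (z - y)) (u z)"
  have "(\<lambda>p. norm (?h p)) summable_on UNIV \<times> UNIV"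
  proof (rule Infinite_Sum.abs_summable_on_comparison_test')
    show "(\<lambda>(z, y). cmod (a y) * cmod (b (z - y)) * 1) summable_on UNIV \<times> UNIV"
      by (rule conv_pair_summable[OF a b, of 1]) auto
    show "norm (?h p) \<le> (case p of (z, y) \<Rightarrow> cmod (a y) * cmod (b (z - y)) * 1)" for p
      using norm_cscale_u by (auto simp: case_prod_unfold norm_mult norm_\<kappa> intro!: order_trans[OF norm_cscale_u])
  qed
  then have "?h summable_on UNIV \<times> UNIV"
    by (rule abs_summable_summable)
  then obtain S where S: "(?h has_sum S) (UNIV \<times> UNIV)"
    unfolding summable_on_def by blast
  have "((\<lambda>z. cscale_op (conv a b z) (u z)) has_sum S) UNIV"
  proof (rule has_sum_SigmaD[OF S])
    show "((\<lambda>y. ?h (z, y)) has_sum cscale_op (conv a b z) (u z)) UNIV" for z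
      using has_sum_bounded_linear[OF cscale_op.bounded_linear_left conv_has_sum[OF a b]] by simp
  qed
  then have "op (conv a b) = S"
    by (rule op_eqI)
  moreover have "((\<lambda>y. cscale_op (a y) (u y) o\<^sub>L op b) has_sum S) UNIV"
  proof (rule has_sum_SigmaD)
    show "((\<lambda>(y, x). cscale_op (a y) (u y) o\<^sub>L cscale_op (b x) (u x)) has_sum S) (UNIV \<times> UNIV)"
      by (rule has_sum_reindex_bij_witness[where S = "UNIV \<times> UNIV" and T = "UNIV \<times> UNIV"
          and j = "\<lambda>(y :: 'g, x :: 'g). (y + x, y)" and i = "\<lambda>(z :: 'g, y :: 'g). (y, z - y)", THEN iffD2, OF _ _ _ _ _ _ S])
        (auto simp: cscale_op_compose_left cscale_op_compose_right u_ops u_mult cscale_op_cscale_op mult_ac)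
    show "((\<lambda>x. case (y, x) of (y, x) \<Rightarrow> cscale_op (a y) (u y) o\<^sub>L cscale_op (b x) (u x))
        has_sum cscale_op (a y) (u y) o\<^sub>L op b) UNIV" for y
      using has_sum_bounded_linear[OF bounded_bilinear.bounded_linear_right[OF bounded_bilinear_blinfun_compose]
          has_sum_op[OF b]] by simp
  qed
  moreover have "((\<lambda>y. cscale_op (a y) (u y) o\<^sub>L op b) has_sum op a o\<^sub>L op b) UNIV"
    by (rule has_sum_bounded_linear[OF bounded_bilinear.bounded_linear_left[OF bounded_bilinear_blinfun_compose]
          has_sum_op[OF a]])
  ultimately show ?thesis
    using has_sum_unique by blast
qed

lemma star_wl1:
  assumes a: "a \<in> wl1 w" and even: "\<And>z. w (- z) = w z"
  shows "star a \<in> wl1 w"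
proof -
  have "(\<lambda>z. cmod (a z) * w z) summable_on UNIV"
    using a by (simp add: wl1_def)
  then have "(\<lambda>z. cmod (a (- z)) * w z) summable_on UNIV"
    by (rule summable_on_reindex_bij_witness[where S = UNIV and T = UNIV
          and i = "uminus :: 'g \<Rightarrow> 'g" and j = "uminus :: 'g \<Rightarrow> 'g", THEN iffD1, rotated -1]) (auto simp: even)
  then show ?thesis
    unfolding wl1_def star_def by (simp add: norm_mult norm_\<eta>)
qed

lemma is_adjoint_op_star:
  assumes a: "a \<in> l1"
  shows "is_adjoint (op a) (op (star a))"
proof -
  have "((\<lambda>z. cscale_op (star a z) (u z)) has_sum op (star a)) UNIV"
    by (intro has_sum_op star_wl1 a) simp
  \<comment> \<open>Reindexing by negation makes the partial sums of the two series over the same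
    finite set adjoint to each other, so the relation passes to the limit.\<close>
  then have "((\<lambda>z. cscale_op (star a (- z)) (u (- z))) has_sum op (star a)) UNIV"
    by (rule has_sum_reindex_bij_witness[where S = UNIV and T = UNIV
          and i = "uminus :: 'g \<Rightarrow> 'g" and j = "uminus :: 'g \<Rightarrow> 'g", THEN iffD1, rotated -1]) auto
  then have "((\<lambda>z. cscale_op (cnj (a z)) (cscale_op (\<eta> z) (u (- z)))) has_sum op (star a)) UNIV"
    by (simp add: star_def cscale_op_cscale_op)
  then have B: "(sum (\<lambda>z. cscale_op (cnj (a z)) (cscale_op (\<eta> z) (u (- z)))) \<longlongrightarrow> op (star a))
      (finite_subsets_at_top UNIV)"
    by (simp add: has_sum_def)
  have A: "(sum (\<lambda>z. cscale_op (a z) (u z)) \<longlongrightarrow> op a) (finite_subsets_at_top UNIV)"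
    using has_sum_op[OF a] by (simp add: has_sum_def)
  show ?thesis
  proof (rule is_adjoint_lim[OF A B])
    show "is_adjoint (\<Sum>z\<in>F. cscale_op (a z) (u z))
        (\<Sum>z\<in>F. cscale_op (cnj (a z)) (cscale_op (\<eta> z) (u (- z))))" for F
      by (intro is_adjoint_sum is_adjoint_cscale u_adjoint)
  qed simp
qed

end

section \<open>Bounding coefficients by the operator norm\<close>

text \<open>A nonzero vector forces the identity to have norm 1, on which the bound of a coefficient
  by the operator norm ultimately rests.\<close>

lemma L2_nontrivial: "\<exists>f :: 'a::euclidean_space L2. f \<noteq> 0"
proof
  let ?f = "\<lambda>t :: 'a. complex_of_real (indicator (cbox 0 One) t)"
  have eq: "(\<integral>\<^sup>+ t. ennreal ((cmod (?f t))\<^sup>2) \<partial>lborel) = 1"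
  proof -
    have "(\<integral>\<^sup>+ t. ennreal ((cmod (?f t))\<^sup>2) \<partial>lborel) = (\<integral>\<^sup>+ t. indicator (cbox 0 (One :: 'a)) t \<partial>lborel)"
      by (intro nn_integral_cong) (auto simp: indicator_def)
    also have "\<dots> = 1"
      by (simp add: emeasure_lborel_cbox)
    finally show ?thesis .
  qed
  have "square_integrable ?f"
    by (rule square_integrableI) (measurable, simp only: eq, simp)
  then have "ennreal ((norm (abs_L2 ?f))\<^sup>2) = 1"
    by (simp only: norm_abs_L2 eq)
  then show "abs_L2 ?f \<noteq> 0"
    by auto
qed

lemma norm_cscale_op_id: "norm (cscale_op c (id_blinfun :: 'a::euclidean_space L2_op)) = cmod c"
proof (rule antisym)
  show "norm (cscale_op c (id_blinfun :: 'a L2_op)) \<le> cmod c"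
    by (rule norm_blinfun_bound) (auto simp: cscale_op_apply norm_cscale_L2)
  obtain f :: "'a L2" where "f \<noteq> 0"
    using L2_nontrivial by blast
  have "cmod c * norm f \<le> norm (cscale_op c (id_blinfun :: 'a L2_op)) * norm f"
    using norm_blinfun[of "cscale_op c id_blinfun" f] by (simp add: cscale_op_apply norm_cscale_L2)
  then show "cmod c \<le> norm (cscale_op c (id_blinfun :: 'a L2_op))"
    using \<open>f \<noteq> 0\<close> by simp
qed

text \<open>Dominated convergence for unordered sums: outside a finite set \<open>F\<close> the
  majorant contributes at most \<open>e / 2\<close>, and on \<open>F\<close> only finitely many
  sequences have to become small.\<close>

lemma infsum_dominated_tendsto_0:
  fixes f :: "nat \<Rightarrow> 'b \<Rightarrow> real"
  assumes g: "g summable_on UNIV" and f: "\<And>n z. 0 \<le> f n z" "\<And>n z. f n z \<le> g z"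
    and lim: "\<And>z. (\<lambda>n. f n z) \<longlonglongrightarrow> 0"
  shows "(\<lambda>n. \<Sum>\<^sub>\<infinity>z. f n z) \<longlonglongrightarrow> 0"
proof (rule tendstoI)
  fix e :: real assume "0 < e"
  then obtain F where F: "finite F" "dist (sum g F) (infsum g UNIV) \<le> e / 2"
    using infsum_finite_approximation[OF g, of "e / 2"] by auto
  have sf: "f n summable_on UNIV" for n
    by (rule summable_on_comparison_test[OF g]) (auto simp: f)
  have bound: "infsum (f n) UNIV \<le> sum (f n) F + e / 2" for n
  proof -
    have s: "(\<lambda>z. g z - f n z) summable_on UNIV"
      using summable_on_add[OF g summable_on_uminus[THEN iffD2, OF sf[of n]]] by simp
    have "sum (\<lambda>z. g z - f n z) F \<le> infsum (\<lambda>z. g z - f n z) UNIV"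
      by (rule finite_sum_le_infsum[OF s F(1)]) (auto simp: f)
    also have "\<dots> = infsum g UNIV - infsum (f n) UNIV"
      using infsum_add[OF g summable_on_uminus[THEN iffD2, OF sf[of n]]] infsum_uminus[of "f n" UNIV] by simp
    finally show ?thesis
      using F(2) unfolding dist_real_def sum_subtractf by linarith
  qed
  have "(\<lambda>n. sum (f n) F) \<longlonglongrightarrow> 0"
    using tendsto_sum[of F "\<lambda>z n. f n z" "\<lambda>_. 0"] lim by simp
  then have "eventually (\<lambda>n. sum (f n) F < e / 2) sequentially"
    using \<open>0 < e\<close> by (intro order_tendstoD) auto
  then show "eventually (\<lambda>n. dist (infsum (f n) UNIV) 0 < e) sequentially"
  proof (rule eventually_mono)
    fix n assume "sum (f n) F < e / 2"
    then have "infsum (f n) UNIV < e"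
      using bound[of n] by simp
    moreover have "0 \<le> infsum (f n) UNIV"
      by (rule infsum_nonneg) (simp add: f)
    ultimately show "dist (infsum (f n) UNIV) 0 < e"
      by (simp add: dist_real_def)
  qed
qed

text \<open>For \<open>x \<noteq> 1\<close> the geometric sums stay below
  \<open>2 / cmod (x - 1)\<close>, so dividing by their length sends them to 0. Starting at
  \<open>Suc n\<close> keeps the divisor nonzero.\<close>

lemma average_powers_tendsto:
  fixes x :: complex
  assumes "cmod x = 1"
  shows "(\<lambda>n. (\<Sum>m<Suc n. x ^ m) / of_nat (Suc n)) \<longlonglongrightarrow> (if x = 1 then 1 else 0)"
proof (cases "x = 1")
  case True
  have "(\<Sum>m<Suc n. x ^ m) / of_nat (Suc n) = 1" for n
    unfolding True by (simp del: of_nat_Suc)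
  then show ?thesis
    using True by simp
next
  case False
  have bound: "cmod ((\<Sum>m<Suc n. x ^ m) / of_nat (Suc n)) \<le> 2 / cmod (x - 1) * inverse (real (Suc n))" for n
  proof -
    have "cmod (x ^ Suc n - 1) \<le> 2"
      by (rule order_trans[OF norm_triangle_ineq4]) (simp add: norm_power assms del: power_Suc)
    then have "cmod (\<Sum>m<Suc n. x ^ m) \<le> 2 / cmod (x - 1)"
      unfolding geometric_sum[OF False] norm_divide by (intro divide_right_mono) auto
    then show ?thesis
      by (simp only: norm_divide norm_of_nat divide_inverse[of _ "real (Suc n)"] mult_right_mono inverse_nonnegative_iff_nonnegative of_nat_0_le_iff)
  qed
  have "(\<lambda>n. 2 / cmod (x - 1) * inverse (real (Suc n))) \<longlonglongrightarrow> 2 / cmod (x - 1) * 0"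
    by (intro tendsto_mult tendsto_const LIMSEQ_inverse_real_of_nat)
  then have "(\<lambda>n. 2 / cmod (x - 1) * inverse (real (Suc n))) \<longlonglongrightarrow> 0"
    by (simp only: mult_zero_right)
  then have "(\<lambda>n. (\<Sum>m<Suc n. x ^ m) / of_nat (Suc n)) \<longlonglongrightarrow> 0"
    by (rule Lim_null_comparison[rotated]) (rule always_eventually, rule allI, rule bound)
  then show ?thesis
    by (simp only: if_not_P[OF False])
qed

text \<open>The operators \<open>V\<close>, \<open>V'\<close> spatially implement the gauge action in the direction \<open>\<phi>\<close>
  at a point of infinite order on the circle.\<close>

locale graded_rep = twisted_rep u \<kappa> \<eta>
  for u :: "'g::ab_group_add \<Rightarrow> 'a::euclidean_space L2_op" and \<kappa> \<eta> +
  fixes \<Phi> :: "('g \<Rightarrow> int) set"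
  assumes finite_\<Phi>: "finite \<Phi>"
    and \<Phi>_add: "\<phi> \<in> \<Phi> \<Longrightarrow> \<phi> (y + z) = \<phi> y + \<phi> z"
    and \<Phi>_separates: "(\<And>\<phi>. \<phi> \<in> \<Phi> \<Longrightarrow> \<phi> z = 0) \<Longrightarrow> z = 0"
    and \<Phi>_implemented: "\<phi> \<in> \<Phi> \<Longrightarrow> \<exists>V V' \<zeta>. V \<in> bounded_ops \<and> norm V \<le> 1 \<and> norm V' \<le> 1 \<and>
      cmod \<zeta> = 1 \<and> (\<forall>n. n \<noteq> 0 \<longrightarrow> \<zeta> powi n \<noteq> 1) \<and>
      (\<forall>z. V o\<^sub>L u z o\<^sub>L V' = cscale_op (\<zeta> powi \<phi> z) (u z))"
begin

text \<open>Each conjugation by \<open>V\<close> and \<open>V'\<close> multiplies the coefficient at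
  \<open>z\<close> by \<open>x z\<close> without increasing the norm; iterating it gives the powers,
  and the triangle inequality gives the sum.\<close>

lemma norm_op_average_le:
  assumes a: "a \<in> l1" and V: "V \<in> bounded_ops" "norm V \<le> 1" "norm V' \<le> 1"
    and x: "\<And>z. cmod (x z) = 1" "\<And>z. V o\<^sub>L u z o\<^sub>L V' = cscale_op (x z) (u z)"
  shows "norm (op (\<lambda>z. (\<Sum>m<n. x z ^ m) * a z)) \<le> real n * norm (op a)"
proof -
  have l1: "(\<lambda>z. c z * b z) \<in> l1" if "b \<in> l1" "\<And>z. cmod (c z) \<le> C" for b c C
    by (rule wl1_comparison[OF that(1), where C = C])
      (use that(2) in \<open>auto simp: norm_mult intro: mult_right_mono\<close>)
  have rotate: "norm (op (\<lambda>z. x z * b z)) \<le> norm (op b)" if b: "b \<in> l1" for b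
  proof -
    have "bounded_linear (\<lambda>X. V o\<^sub>L X o\<^sub>L V')"
      by (rule bounded_linear_compose[OF
            bounded_bilinear.bounded_linear_left[OF bounded_bilinear_blinfun_compose]
            bounded_bilinear.bounded_linear_right[OF bounded_bilinear_blinfun_compose]])
    from has_sum_bounded_linear[OF this has_sum_op[OF b]]
    have "((\<lambda>z. V o\<^sub>L cscale_op (b z) (u z) o\<^sub>L V') has_sum V o\<^sub>L op b o\<^sub>L V') UNIV" .
    then have "((\<lambda>z. cscale_op (x z * b z) (u z)) has_sum V o\<^sub>L op b o\<^sub>L V') UNIV"
      by (simp add: cscale_op_compose_right[OF V(1)] cscale_op_compose_left x cscale_op_cscale_op mult.commute)
    then have "op (\<lambda>z. x z * b z) = V o\<^sub>L op b o\<^sub>L V'"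
      by (rule op_eqI)
    also have "norm \<dots> \<le> norm V * norm (op b) * norm V'"
      by (rule order_trans[OF norm_blinfun_compose mult_right_mono[OF norm_blinfun_compose]]) simp
    also have "\<dots> \<le> 1 * norm (op b) * 1"
      by (intro mult_mono V) auto
    finally show ?thesis by simp
  qed
  have power: "(\<lambda>z. x z ^ m * a z) \<in> l1 \<and> norm (op (\<lambda>z. x z ^ m * a z)) \<le> norm (op a)" for m
  proof (induct m)
    case 0
    then show ?case using a by simp
  next
    case (Suc m)
    then show ?case
      using rotate[of "\<lambda>z. x z ^ m * a z"] l1[of "\<lambda>z. x z ^ m * a z" x 1]
      by (auto simp: x(1) mult.assoc)
  qed
  show ?thesis
  proof (induct n)
    case 0
    have "op (\<lambda>z. 0) = 0"
      by (rule op_eqI) (simp add: cscale_op.zero_left)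
    then show ?case by simp
  next
    case (Suc n)
    have *: "(\<lambda>z. (\<Sum>m<n. x z ^ m) * a z) \<in> l1"
    proof (rule l1[OF a])
      show "cmod (\<Sum>m<n. x z ^ m) \<le> real n" for z
        using sum_norm_le[of "{..<n}" "\<lambda>m. x z ^ m" "\<lambda>_. 1"] by (simp add: norm_power x(1))
    qed
    have "op (\<lambda>z. (\<Sum>m<Suc n. x z ^ m) * a z) =
        op (\<lambda>z. (\<Sum>m<n. x z ^ m) * a z) + op (\<lambda>z. x z ^ n * a z)"
      using op_add[OF * conjunct1[OF power]] by (simp add: distrib_right)
    also have "norm \<dots> \<le> real n * norm (op a) + norm (op a)"
      by (rule order_trans[OF norm_triangle_ineq add_mono]) (use Suc power in auto)
    finally show ?case
      by (simp add: distrib_right)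
  qed
qed

text \<open>This restriction is a conditional expectation. As \<zeta> has infinite order,
  \<open>x z = 1\<close> holds exactly on the kernel of \<phi>, so averages of the rotated
  coefficients converge pointwise to the restricted ones. Domination by
  \<open>2 * cmod (a z)\<close> upgrades this to l1 convergence, hence to convergence in operator
  norm, and the averages never exceed the norm of \<open>op a\<close>.\<close>

lemma norm_op_restrict_le:
  assumes a: "a \<in> l1" and "\<phi> \<in> \<Phi>"
  shows "norm (op (\<lambda>z. if \<phi> z = 0 then a z else 0)) \<le> norm (op a)"
proof -
  obtain V V' \<zeta> where V: "V \<in> bounded_ops" "norm V \<le> 1" "norm V' \<le> 1"
    and \<zeta>: "cmod \<zeta> = 1" "\<And>n. n \<noteq> 0 \<Longrightarrow> \<zeta> powi n \<noteq> 1"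
    and conj: "\<And>z. V o\<^sub>L u z o\<^sub>L V' = cscale_op (\<zeta> powi \<phi> z) (u z)"
    using \<Phi>_implemented[OF assms(2)] by blast
  define x where "x z = \<zeta> powi \<phi> z" for z
  have x: "cmod (x z) = 1" "x z = 1 \<longleftrightarrow> \<phi> z = 0" for z
    using \<zeta> by (auto simp: x_def norm_power_int)
  define E where "E n z = (\<Sum>m<Suc n. x z ^ m) / of_nat (Suc n) * a z" for n z
  define P where "P z = (if \<phi> z = 0 then a z else 0)" for z
  have c_le: "cmod ((\<Sum>m<Suc n. x z ^ m) / of_nat (Suc n)) \<le> 1" for n z
  proof -
    have "cmod (\<Sum>m<Suc n. x z ^ m) \<le> real (Suc n)"
      using sum_norm_le[of "{..<Suc n}" "\<lambda>m. x z ^ m" "\<lambda>_. 1"] by (simp add: norm_power x(1))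
    then show ?thesis
      by (simp add: norm_divide del: of_nat_Suc sum.lessThan_Suc)
  qed
  have S_l1: "(\<lambda>z. (\<Sum>m<Suc n. x z ^ m) * a z) \<in> l1" for n
  proof (rule wl1_comparison[OF a, where C = "real (Suc n)"])
    show "cmod ((\<Sum>m<Suc n. x z ^ m) * a z) * 1 \<le> real (Suc n) * (cmod (a z) * 1)" for z
      using sum_norm_le[of "{..<Suc n}" "\<lambda>m. x z ^ m" "\<lambda>_. 1"]
      by (simp add: norm_power x(1) norm_mult mult_right_mono del: of_nat_Suc sum.lessThan_Suc)
  qed simp
  have E_eq: "E n = (\<lambda>z. complex_of_real (inverse (real (Suc n))) * ((\<Sum>m<Suc n. x z ^ m) * a z))" for n
    by (simp add: E_def fun_eq_iff divide_inverse mult_ac del: of_nat_Suc sum.lessThan_Suc)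
  have E_l1: "E n \<in> l1" for n
    unfolding E_eq by (rule wl1_cmult[OF S_l1])
  have norm_E: "norm (op (E n)) \<le> norm (op a)" for n
  proof -
    have "op (E n) = inverse (real (Suc n)) *\<^sub>R op (\<lambda>z. (\<Sum>m<Suc n. x z ^ m) * a z)"
      unfolding E_eq by (simp only: op_cmult[OF S_l1] cscale_op_of_real)
    then have "norm (op (E n)) = inverse (real (Suc n)) * norm (op (\<lambda>z. (\<Sum>m<Suc n. x z ^ m) * a z))"
      by (simp del: of_nat_Suc sum.lessThan_Suc)
    also have "\<dots> \<le> inverse (real (Suc n)) * (real (Suc n) * norm (op a))"
      by (intro mult_left_mono norm_op_average_le[OF a V x(1)]) (auto simp: conj x_def)
    also have "\<dots> = norm (op a)"
      by (simp add: field_simps)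
    finally show ?thesis .
  qed
  have P_l1: "P \<in> l1"
    by (rule wl1_comparison[OF a, where C = 1]) (auto simp: P_def)
  have minus_l1: "(\<lambda>z. - 1 * P z) \<in> l1"
    by (rule wl1_cmult[OF P_l1])
  have diff_l1: "(\<lambda>z. E n z + - 1 * P z) \<in> l1" for n
    by (rule wl1_add[OF E_l1 minus_l1]) simp
  have op_diff: "op (\<lambda>z. E n z + - 1 * P z) = op (E n) - op P" for n
    using op_add[OF E_l1 minus_l1] op_cmult[OF P_l1, of "- 1"] cscale_op_of_real[of "- 1" "op P"] by simp
  have "(\<lambda>n. \<Sum>\<^sub>\<infinity>z. cmod (E n z + - 1 * P z)) \<longlonglongrightarrow> 0"
  proof (rule infsum_dominated_tendsto_0)
    show "(\<lambda>z. 2 * cmod (a z)) summable_on UNIV"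
      using a by (intro summable_on_cmult_right) (simp add: wl1_def)
    show "cmod (E n z + - 1 * P z) \<le> 2 * cmod (a z)" for n z
    proof -
      have "cmod (E n z) \<le> 1 * cmod (a z)"
        unfolding E_def norm_mult by (intro mult_right_mono c_le) simp
      moreover have "cmod (P z) \<le> cmod (a z)"
        by (simp add: P_def)
      ultimately show ?thesis
        using norm_triangle_ineq4[of "E n z" "P z"] by simp
    qed
    show "(\<lambda>n. cmod (E n z + - 1 * P z)) \<longlonglongrightarrow> 0" for z
    proof -
      have "(\<lambda>n. E n z) \<longlonglongrightarrow> (if x z = 1 then 1 else 0) * a z"
        unfolding E_def by (intro tendsto_mult average_powers_tendsto x(1) tendsto_const)
      moreover have "(if x z = 1 then 1 else 0) * a z = P z"
        by (simp add: P_def x(2))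
      ultimately have "(\<lambda>n. E n z) \<longlonglongrightarrow> P z"
        by simp
      then show ?thesis
        using tendsto_norm_zero[OF LIM_zero] by simp
    qed
  qed simp
  then have "(\<lambda>n. op (E n) - op P) \<longlonglongrightarrow> 0"
  proof (rule Lim_null_comparison[rotated], intro always_eventually allI)
    show "norm (op (E n) - op P) \<le> (\<Sum>\<^sub>\<infinity>z. cmod (E n z + - 1 * P z))" for n
      using norm_op_le[OF diff_l1] by (simp only: op_diff)
  qed
  then have "(\<lambda>n. norm (op (E n))) \<longlonglongrightarrow> norm (op P)"
    by (rule tendsto_norm[OF LIM_zero_cancel])
  then have "norm (op P) \<le> norm (op a)"
    by (rule LIMSEQ_le_const2) (use norm_E in auto)
  then show ?thesis
    unfolding P_def .
qed

text \<open>Restricting to the kernels of the finitely many members of \<Phi> one after another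
  leaves only the point 0, because \<Phi> separates points; what remains is a scalar multiple of the
  identity.\<close>

lemma coeff_0_le:
  assumes a: "a \<in> l1"
  shows "cmod (a 0) \<le> norm (op a)"
proof -
  have restrict: "norm (op (\<lambda>z. if \<forall>\<phi>\<in>\<Psi>. \<phi> z = 0 then a z else 0)) \<le> norm (op a)" if "\<Psi> \<subseteq> \<Phi>" for \<Psi>
    using finite_subset[OF that finite_\<Phi>] that
  proof (induct \<Psi> rule: finite_induct)
    case empty
    then show ?case by simp
  next
    case (insert \<phi> \<Psi>)
    let ?b = "\<lambda>z. if \<forall>\<phi>\<in>\<Psi>. \<phi> z = 0 then a z else 0"
    have "?b \<in> l1"
      by (rule wl1_comparison[OF a, where C = 1]) auto
    moreover have "(\<lambda>z. if \<phi> z = 0 then ?b z else 0) = (\<lambda>z. if \<forall>\<phi>\<in>insert \<phi> \<Psi>. \<phi> z = 0 then a z else 0)"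
      by auto
    ultimately show ?case
      using norm_op_restrict_le[of ?b \<phi>] insert by simp
  qed
  have "\<phi> 0 = 0" if "\<phi> \<in> \<Phi>" for \<phi>
    using \<Phi>_add[OF that, of 0 0] by simp
  then have "(\<lambda>z. if \<forall>\<phi>\<in>\<Phi>. \<phi> z = 0 then a z else 0) = (\<lambda>z. if z = 0 then a 0 else 0)"
    using \<Phi>_separates by (auto simp: fun_eq_iff)
  then have "norm (op (\<lambda>z. if z = 0 then a 0 else 0)) \<le> norm (op a)"
    using restrict[of \<Phi>] by simp
  then show ?thesis
    by (simp add: op_delta u_0 norm_cscale_op_id)
qed

text \<open>Right multiplication by the contraction \<open>u (- z)\<close> moves the coefficient at
  \<open>z\<close> to 0, up to a factor of modulus 1.\<close>

lemma coeff_le: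
  assumes a: "a \<in> l1"
  shows "cmod (a z) \<le> norm (op a)"
proof -
  let ?d = "\<lambda>y. if y = - z then 1 else (0 :: complex)"
  have d: "?d \<in> l1"
    by (rule wl1_delta)
  have "conv a ?d 0 = a z * \<kappa> z (- z)"
  proof -
    have "((\<lambda>y. a y * ?d (0 - y) * \<kappa> y (0 - y)) has_sum a z * \<kappa> z (- z)) {z}"
      by (rule has_sum_finiteI) auto
    then have "((\<lambda>y. a y * ?d (0 - y) * \<kappa> y (0 - y)) has_sum a z * \<kappa> z (- z)) UNIV"
      by (rule has_sum_cong_neutral[THEN iffD1, rotated -1]) auto
    then show ?thesis
      unfolding conv_def by (rule infsumI)
  qed
  then have "cmod (a z) = cmod (conv a ?d 0)"
    by (simp add: norm_mult norm_\<kappa>)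
  also have "\<dots> \<le> norm (op (conv a ?d))"
    by (rule coeff_0_le[OF conv_l1[OF a d]])
  also have "\<dots> = norm (op a o\<^sub>L u (- z))"
    by (simp add: op_conv[OF a d] op_delta)
  also have "\<dots> \<le> norm (op a) * norm (u (- z))"
    by (rule norm_blinfun_compose)
  also have "\<dots> \<le> norm (op a)"
    by (simp add: mult_left_le norm_u)
  finally show ?thesis .
qed

end

section \<open>Moments and the Neumann series\<close>

lemma has_sum_finite_sum:
  fixes f :: "'i \<Rightarrow> 'b \<Rightarrow> 'c::{comm_monoid_add, topological_comm_monoid_add}"
  assumes "finite I" "\<And>i. i \<in> I \<Longrightarrow> (f i has_sum S i) A"
  shows "((\<lambda>x. \<Sum>i\<in>I. f i x) has_sum (\<Sum>i\<in>I. S i)) A"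
  using assms by (induct I rule: finite_induct) (simp_all add: has_sum_add)

lemma geometric_recursion_bound:
  fixes x :: "nat \<Rightarrow> real"
  assumes rec: "\<And>n. x (Suc n) \<le> \<rho> * x n + K * \<theta> ^ n" and "0 \<le> \<rho>" "\<rho> < \<theta>"
  shows "\<exists>C. \<forall>n. x n \<le> C * \<theta> ^ n"
proof -
  \<comment> \<open>The first entry starts the induction; the second solves
    \<open>\<rho> * C + K \<le> C * \<theta>\<close>, which propagates it and needs the strict gap
    between the two rates.\<close>
  define C where "C = max (x 0) (K / (\<theta> - \<rho>))"
  have "K / (\<theta> - \<rho>) \<le> C"
    by (simp add: C_def)
  then have K: "\<rho> * C + K \<le> C * \<theta>"
    using assms(3) by (simp add: field_simps)
  have "x n \<le> C * \<theta> ^ n" for n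
  proof (induct n)
    case 0
    then show ?case by (simp add: C_def)
  next
    case (Suc n)
    have "x (Suc n) \<le> \<rho> * (C * \<theta> ^ n) + K * \<theta> ^ n"
      using rec[of n] mult_left_mono[OF Suc assms(2)] by linarith
    also have "\<dots> = (\<rho> * C + K) * \<theta> ^ n"
      by (simp add: algebra_simps)
    also have "\<dots> \<le> C * \<theta> * \<theta> ^ n"
      using assms by (intro mult_right_mono[OF K]) simp
    finally show ?case by (simp add: mult_ac)
  qed
  then show ?thesis by blast
qed

text \<open>A left inverse bounds \<open>A\<close> from below. Expanding the squared norm of
  \<open>f - l A' A f\<close>, the cross term is twice \<open>l * (norm (A f))\<^sup>2\<close> and
  outweighs the quadratic term for small \<open>l\<close>. This elementary estimate stands in for
  the spectral theory of positive operators.\<close>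

lemma norm_id_minus_adjoint_compose_less_1:
  fixes A :: "'a::euclidean_space L2_op"
  assumes adj: "is_adjoint A A'" and inv: "B o\<^sub>L A = id_blinfun"
  shows "\<exists>l>0. norm (id_blinfun - l *\<^sub>R (A' o\<^sub>L A)) < 1"
proof -
  \<comment> \<open>\<open>l * (norm A')\<^sup>2 \<le> 1\<close> keeps the quadratic term below half
    of the cross term; the summand 1 avoids a zero denominator and gives
    \<open>l \<le> 1\<close>.\<close>
  define l where "l = 1 / ((norm A')\<^sup>2 + 1)"
  have l: "0 < l" "l * (norm A')\<^sup>2 \<le> 1" "l \<le> 1"
    by (auto simp: l_def field_simps add_pos_nonneg)
  \<comment> \<open>Adding 1 gives \<open>N \<ge> 1\<close>, so that
    \<open>l / N\<^sup>2 \<le> 1\<close> and the square root of \<open>c\<close> is taken of a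
    nonnegative number.\<close>
  define N where "N = norm B + 1"
  have N: "1 \<le> N" by (simp add: N_def)
  define c where "c = 1 - l / N\<^sup>2"
  have "l / N\<^sup>2 \<le> 1"
    using l N by (simp add: divide_le_eq_1 order_trans[OF l(3)])
  then have c: "0 \<le> c" "c < 1"
    using l N by (auto simp: c_def)
  have "norm (id_blinfun - l *\<^sub>R (A' o\<^sub>L A)) \<le> sqrt c"
  proof (rule norm_blinfun_bound)
    fix f
    have "f = B (A f)"
      by (metis blinfun_apply_blinfun_compose blinfun_apply_id_blinfun inv)
    then have "norm f \<le> norm B * norm (A f)"
      using norm_blinfun[of B "A f"] by simp
    also have "\<dots> \<le> N * norm (A f)"
      by (intro mult_right_mono) (auto simp: N_def)
    finally have "(norm f)\<^sup>2 \<le> (N * norm (A f))\<^sup>2"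
      by (intro power_mono) auto
    then have low: "(norm f)\<^sup>2 / N\<^sup>2 \<le> (norm (A f))\<^sup>2"
      using N by (simp add: power_mult_distrib divide_le_eq mult.commute)
    have "(norm (A' (A f)))\<^sup>2 \<le> (norm A')\<^sup>2 * (norm (A f))\<^sup>2"
      using power_mono[OF norm_blinfun[of A' "A f"], of 2] by (simp add: power_mult_distrib)
    then have "l * (l * (norm (A' (A f)))\<^sup>2) \<le> l * (l * ((norm A')\<^sup>2 * (norm (A f))\<^sup>2))"
      using l by (intro mult_left_mono) auto
    also have "\<dots> = l * ((l * (norm A')\<^sup>2) * (norm (A f))\<^sup>2)"
      by (simp add: mult_ac)
    also have "\<dots> \<le> l * (1 * (norm (A f))\<^sup>2)"
      using l by (intro mult_left_mono mult_right_mono) auto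
    finally have quad: "l * (l * (norm (A' (A f)))\<^sup>2) \<le> l * (norm (A f))\<^sup>2"
      by simp
    have "inner f (A' (A f)) = (norm (A f))\<^sup>2"
      using is_adjoint_inner[OF adj, of f "A f"] by (simp add: dot_square_norm)
    then have "(norm (f - l *\<^sub>R A' (A f)))\<^sup>2 =
        (norm f)\<^sup>2 - 2 * (l * (norm (A f))\<^sup>2) + l * (l * (norm (A' (A f)))\<^sup>2)"
      by (simp add: power2_norm_eq_inner inner_diff_left inner_diff_right right_diff_distrib inner_commute[of "A' (A f)" f])
    also have "\<dots> \<le> (norm f)\<^sup>2 - l * (norm (A f))\<^sup>2"
      using quad by linarith
    also have "\<dots> \<le> (norm f)\<^sup>2 - l * ((norm f)\<^sup>2 / N\<^sup>2)"
      using mult_left_mono[OF low, of l] l by linarith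
    also have "\<dots> = (sqrt c * norm f)\<^sup>2"
      using c(1) by (simp add: power_mult_distrib c_def algebra_simps)
    finally have "norm (f - l *\<^sub>R A' (A f)) \<le> sqrt c * norm f"
      by (rule power2_le_imp_le) (use c in simp)
    then show "norm ((id_blinfun - l *\<^sub>R (A' o\<^sub>L A)) f) \<le> sqrt c * norm f"
      by (simp add: blinfun.diff_left blinfun.scaleR_left)
  qed (use c in simp)
  also have "sqrt c < 1"
    using c by simp
  finally show ?thesis
    using l(1) by blast
qed

section \<open>Powers for the twisted convolution\<close>

context twisted_rep
begin

lemma op_sum:
  assumes "finite I" "\<And>i. i \<in> I \<Longrightarrow> f i \<in> l1"
  shows "(\<lambda>z. \<Sum>i\<in>I. f i z) \<in> l1" "op (\<lambda>z. \<Sum>i\<in>I. f i z) = (\<Sum>i\<in>I. op (f i))"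
proof -
  have "(\<lambda>z. \<Sum>i\<in>I. f i z) \<in> l1 \<and> op (\<lambda>z. \<Sum>i\<in>I. f i z) = (\<Sum>i\<in>I. op (f i))"
    using assms
  proof (induct I rule: finite_induct)
    case empty
    have "op (\<lambda>z. 0) = 0"
      by (rule op_eqI) (simp add: cscale_op.zero_left)
    then show ?case by (simp add: wl1_def)
  next
    case (insert i I)
    then show ?case
      using wl1_add[of "f i" "\<lambda>_. 1" "\<lambda>z. \<Sum>i\<in>I. f i z"] op_add[of "f i" "\<lambda>z. \<Sum>i\<in>I. f i z"] by simp
  qed
  then show "(\<lambda>z. \<Sum>i\<in>I. f i z) \<in> l1" "op (\<lambda>z. \<Sum>i\<in>I. f i z) = (\<Sum>i\<in>I. op (f i))"
    by auto
qed

primrec conv_power :: "('g \<Rightarrow> complex) \<Rightarrow> nat \<Rightarrow> 'g \<Rightarrow> complex" where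
  "conv_power r 0 = (\<lambda>z. if z = 0 then 1 else 0)"
| "conv_power r (Suc n) = conv (conv_power r n) r"

lemma conv_power_wl1:
  assumes "r \<in> wl1 w" "\<And>z. 0 \<le> w z" "\<And>y z. w (y + z) \<le> K * w y * w z"
  shows "conv_power r n \<in> wl1 w"
  by (induct n) (auto intro: wl1_delta conv_wl1[OF _ assms(1), where K = K] assms)

lemma op_conv_power_Suc:
  assumes "r \<in> l1"
  shows "op (conv_power r (Suc n)) = op (conv_power r n) o\<^sub>L op r"
  using op_conv[OF conv_power_wl1[OF assms, of 1] assms] by simp

lemma norm_op_conv_power_le:
  assumes "r \<in> l1"
  shows "norm (op (conv_power r n)) \<le> norm (op r) ^ n"
proof (induct n)
  case 0
  then show ?case by (simp add: op_delta u_0 norm_blinfun_id_le)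
next
  case (Suc n)
  have "norm (op (conv_power r (Suc n))) \<le> norm (op (conv_power r n)) * norm (op r)"
    unfolding op_conv_power_Suc[OF assms] by (rule norm_blinfun_compose)
  also have "\<dots> \<le> norm (op r) ^ n * norm (op r)"
    by (intro mult_right_mono Suc) simp
  finally show ?case by (simp add: mult.commute)
qed

end

section \<open>Moments, decay of powers and weighted inverses\<close>

context graded_rep
begin

definition moment :: "('g \<Rightarrow> int) \<Rightarrow> nat \<Rightarrow> ('g \<Rightarrow> complex) \<Rightarrow> 'g \<Rightarrow> complex" where
  "moment \<phi> m a z = of_int (\<phi> z) ^ m * a z"

text \<open>The sum of the absolute coordinates enters inside the power because 1 plus a subadditive
  function is submultiplicative; the weight also dominates each coordinate power up to order
  \<open>M\<close>.\<close>

definition degree_weight :: "nat \<Rightarrow> 'g \<Rightarrow> real" where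
  "degree_weight M z = (1 + (\<Sum>\<phi>\<in>\<Phi>. real_of_int \<bar>\<phi> z\<bar>)) ^ M"

lemma degree_weight_base_ge: "1 \<le> 1 + (\<Sum>\<phi>\<in>\<Phi>. real_of_int \<bar>\<phi> z\<bar>)"
  by (simp add: sum_nonneg)

lemma degree_weight_ge_1: "1 \<le> degree_weight M z"
  unfolding degree_weight_def by (rule one_le_power[OF degree_weight_base_ge])

lemma degree_weight_nonneg: "0 \<le> degree_weight M z"
  using degree_weight_ge_1[of M z] by simp

lemma degree_weight_submult: "degree_weight M (y + z) \<le> 1 * degree_weight M y * degree_weight M z"
proof -
  let ?s = "\<lambda>z. \<Sum>\<phi>\<in>\<Phi>. real_of_int \<bar>\<phi> z\<bar>"
  have "?s (y + z) \<le> (\<Sum>\<phi>\<in>\<Phi>. real_of_int \<bar>\<phi> y\<bar> + real_of_int \<bar>\<phi> z\<bar>)"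
    by (intro sum_mono) (simp add: \<Phi>_add)
  then have "?s (y + z) \<le> ?s y + ?s z"
    by (simp add: sum.distrib)
  moreover have "0 \<le> ?s y * ?s z"
    by (intro mult_nonneg_nonneg sum_nonneg) auto
  moreover have "(1 + ?s y) * (1 + ?s z) = 1 + ?s y + ?s z + ?s y * ?s z"
    by (simp add: distrib_left distrib_right)
  ultimately have "1 + ?s (y + z) \<le> (1 + ?s y) * (1 + ?s z)"
    by linarith
  then have "(1 + ?s (y + z)) ^ M \<le> ((1 + ?s y) * (1 + ?s z)) ^ M"
    by (intro power_mono) (simp_all add: sum_nonneg)
  then show ?thesis
    by (simp add: degree_weight_def power_mult_distrib)
qed

lemma degree_weight_minus: "degree_weight M (- z) = degree_weight M z"
proof -
  have "\<bar>\<phi> (- z)\<bar> = \<bar>\<phi> z\<bar>" if "\<phi> \<in> \<Phi>" for \<phi>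
    using \<Phi>_add[OF that, of z "- z"] \<Phi>_add[OF that, of 0 0] by simp
  then show ?thesis
    by (simp add: degree_weight_def)
qed

lemma wl1_degree_weight_l1: "a \<in> wl1 (degree_weight M) \<Longrightarrow> a \<in> l1"
  by (rule wl1_mono[where C = 1]) (auto simp: degree_weight_ge_1)

lemma moment_l1:
  assumes a: "a \<in> wl1 (degree_weight M)" and "\<phi> \<in> \<Phi>" "m \<le> M"
  shows "moment \<phi> m a \<in> l1"
proof (rule wl1_comparison[OF a, where C = 1])
  fix z
  have "real_of_int \<bar>\<phi> z\<bar> \<le> 1 + (\<Sum>\<phi>\<in>\<Phi>. real_of_int \<bar>\<phi> z\<bar>)"
    using member_le_sum[of \<phi> \<Phi> "\<lambda>\<phi>. real_of_int \<bar>\<phi> z\<bar>"] assms finite_\<Phi> by simp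
  then have "real_of_int \<bar>\<phi> z\<bar> ^ m \<le> (1 + (\<Sum>\<phi>\<in>\<Phi>. real_of_int \<bar>\<phi> z\<bar>)) ^ m"
    by (intro power_mono) auto
  also have "\<dots> \<le> degree_weight M z"
    unfolding degree_weight_def by (rule power_increasing[OF assms(3) degree_weight_base_ge])
  finally show "cmod (moment \<phi> m a z) * 1 \<le> 1 * (cmod (a z) * degree_weight M z)"
    by (simp add: moment_def norm_mult norm_power mult.commute mult_left_mono)
qed simp

text \<open>The iterated Leibniz rule: under the convolution sum, \<phi> z splits as \<phi> y +
  \<phi> (z - y), and the binomial theorem distributes its power over the two factors.\<close>

lemma moment_conv:
  assumes a: "a \<in> wl1 (degree_weight m)" and b: "b \<in> wl1 (degree_weight m)" and \<phi>: "\<phi> \<in> \<Phi>"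
  shows "moment \<phi> m (conv a b) z =
    (\<Sum>i\<le>m. of_nat (m choose i) * conv (moment \<phi> i a) (moment \<phi> (m - i) b) z)"
proof (rule has_sum_unique)
  let ?p = "\<lambda>y. of_int (\<phi> y) :: complex"
  have "((\<lambda>y. ?p z ^ m * (a y * b (z - y) * \<kappa> y (z - y))) has_sum moment \<phi> m (conv a b) z) UNIV"
    unfolding moment_def
    by (intro has_sum_cmult_right conv_has_sum wl1_degree_weight_l1[OF a] wl1_degree_weight_l1[OF b])
  moreover have "?p z ^ m * (a y * b (z - y) * \<kappa> y (z - y)) =
    (\<Sum>i\<le>m. of_nat (m choose i) * (moment \<phi> i a y * moment \<phi> (m - i) b (z - y) * \<kappa> y (z - y)))" for y
  proof -
    have "?p z = ?p y + ?p (z - y)"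
      using \<Phi>_add[OF \<phi>, of y "z - y"] by simp
    then have "?p z ^ m = (\<Sum>i\<le>m. of_nat (m choose i) * ?p y ^ i * ?p (z - y) ^ (m - i))"
      by (simp add: binomial_ring)
    then show ?thesis
      by (simp add: sum_distrib_left sum_distrib_right moment_def mult_ac)
  qed
  ultimately show "((\<lambda>y. \<Sum>i\<le>m. of_nat (m choose i) *
      (moment \<phi> i a y * moment \<phi> (m - i) b (z - y) * \<kappa> y (z - y))) has_sum moment \<phi> m (conv a b) z) UNIV"
    by simp
  show "((\<lambda>y. \<Sum>i\<le>m. of_nat (m choose i) *
      (moment \<phi> i a y * moment \<phi> (m - i) b (z - y) * \<kappa> y (z - y))) has_sum
      (\<Sum>i\<le>m. of_nat (m choose i) * conv (moment \<phi> i a) (moment \<phi> (m - i) b) z)) UNIV"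
    by (intro has_sum_finite_sum has_sum_cmult_right conv_has_sum moment_l1[OF a \<phi>] moment_l1[OF b \<phi>]) auto
qed

lemma norm_op_moment_conv_le:
  assumes a: "a \<in> wl1 (degree_weight m)" and b: "b \<in> wl1 (degree_weight m)" and \<phi>: "\<phi> \<in> \<Phi>"
  shows "norm (op (moment \<phi> m (conv a b))) \<le>
    (\<Sum>i\<le>m. of_nat (m choose i) * (norm (op (moment \<phi> i a)) * norm (op (moment \<phi> (m - i) b))))"
proof -
  let ?c = "\<lambda>i. conv (moment \<phi> i a) (moment \<phi> (m - i) b)"
  have l1: "moment \<phi> i a \<in> l1" "moment \<phi> (m - i) b \<in> l1" if "i \<le> m" for i
    using that by (auto intro: moment_l1[OF a \<phi>] moment_l1[OF b \<phi>])
  have "moment \<phi> m (conv a b) = (\<lambda>z. \<Sum>i\<le>m. of_nat (m choose i) * ?c i z)"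
    by (rule ext) (rule moment_conv[OF assms])
  then have "op (moment \<phi> m (conv a b)) = (\<Sum>i\<le>m. op (\<lambda>z. of_nat (m choose i) * ?c i z))"
    by (simp only:) (intro op_sum(2) wl1_cmult conv_l1 l1; simp)
  also have "\<dots> = (\<Sum>i\<le>m. cscale_op (of_nat (m choose i)) (op (moment \<phi> i a) o\<^sub>L op (moment \<phi> (m - i) b)))"
    by (intro sum.cong) (simp_all add: op_cmult[OF conv_l1] op_conv l1)
  also have "norm \<dots> \<le> (\<Sum>i\<le>m. of_nat (m choose i) * (norm (op (moment \<phi> i a)) * norm (op (moment \<phi> (m - i) b))))"
  proof (rule sum_norm_le)
    fix i
    show "norm (cscale_op (of_nat (m choose i)) (op (moment \<phi> i a) o\<^sub>L op (moment \<phi> (m - i) b))) \<le>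
      of_nat (m choose i) * (norm (op (moment \<phi> i a)) * norm (op (moment \<phi> (m - i) b)))"
      by (rule order_trans[OF norm_cscale_op])
        (simp only: norm_of_nat, intro mult_left_mono norm_blinfun_compose of_nat_0_le_iff)
  qed
  finally show ?thesis .
qed

text \<open>The Leibniz rule turns bounds on the lower moments into a geometric recursion for the next one.\<close>

lemma moment_conv_power_bound:
  assumes r: "r \<in> wl1 (degree_weight M)" and \<theta>: "norm (op r) < \<theta>" and \<phi>: "\<phi> \<in> \<Phi>"
  shows "m \<le> M \<Longrightarrow> \<exists>C. \<forall>n. norm (op (moment \<phi> m (conv_power r n))) \<le> C * \<theta> ^ n"
proof (induct m rule: less_induct)
  case (less m)
  let ?x = "\<lambda>i n. norm (op (moment \<phi> i (conv_power r n)))"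
  have "\<forall>i\<in>{..<m}. \<exists>C. \<forall>n. ?x i n \<le> C * \<theta> ^ n"
    using less by auto
  then obtain C where C: "\<And>i n. i < m \<Longrightarrow> ?x i n \<le> C i * \<theta> ^ n"
    by (auto dest!: bchoice)
  let ?N = "\<lambda>i. norm (op (moment \<phi> i r))"
  define K where "K = (\<Sum>i<m. of_nat (m choose i) * (C i * ?N (m - i)))"
  have r_m: "r \<in> wl1 (degree_weight m)"
    by (rule wl1_mono[OF r, where C = 1])
      (use less.prems in \<open>auto simp: degree_weight_nonneg degree_weight_def intro!: power_increasing degree_weight_base_ge sum_nonneg\<close>)
  have "?x m (Suc n) \<le> norm (op r) * ?x m n + K * \<theta> ^ n" for n
  proof -
    have "?x m (Suc n) \<le> (\<Sum>i\<le>m. of_nat (m choose i) * (?x i n * ?N (m - i)))"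
      unfolding conv_power.simps
      by (rule norm_op_moment_conv_le[OF _ r_m \<phi>])
        (rule conv_power_wl1[OF r_m degree_weight_nonneg degree_weight_submult])
    also have "\<dots> = ?x m n * ?N 0 + (\<Sum>i<m. of_nat (m choose i) * (?x i n * ?N (m - i)))"
      by (simp flip: lessThan_Suc_atMost)
    also have "\<dots> \<le> ?x m n * ?N 0 + (\<Sum>i<m. of_nat (m choose i) * ((C i * \<theta> ^ n) * ?N (m - i)))"
      by (intro add_left_mono sum_mono mult_left_mono mult_right_mono C) auto
    also have "(\<Sum>i<m. of_nat (m choose i) * ((C i * \<theta> ^ n) * ?N (m - i))) = K * \<theta> ^ n"
      by (simp add: K_def sum_distrib_left mult_ac)
    also have "moment \<phi> 0 r = r"
      by (simp add: moment_def fun_eq_iff)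
    finally show ?thesis by (simp add: mult.commute)
  qed
  then show ?case
    by (rule geometric_recursion_bound) (use \<theta> in auto)
qed

text \<open>\<open>coeff_le\<close> turns the operator bounds on moments into pointwise bounds.
  Moments of order \<open>M\<close> carry no information where a coordinate vanishes, so the
  unweighted bound is added to them and yields the summand 1.\<close>

lemma coeff_conv_power_bound:
  assumes r: "r \<in> wl1 (degree_weight M)" and \<theta>: "norm (op r) < \<theta>"
  shows "\<exists>C. \<forall>n z. cmod (conv_power r n z) * (1 + (\<Sum>\<phi>\<in>\<Phi>. real_of_int \<bar>\<phi> z\<bar> ^ M)) \<le> C * \<theta> ^ n"
proof -
  have p: "conv_power r n \<in> wl1 (degree_weight M)" for n
    by (rule conv_power_wl1[OF r degree_weight_nonneg degree_weight_submult])
  have "\<forall>\<phi>\<in>\<Phi>. \<exists>C. \<forall>n. norm (op (moment \<phi> M (conv_power r n))) \<le> C * \<theta> ^ n"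
    using moment_conv_power_bound[OF r \<theta>] by blast
  then obtain C where C: "\<And>\<phi> n. \<phi> \<in> \<Phi> \<Longrightarrow> norm (op (moment \<phi> M (conv_power r n))) \<le> C \<phi> * \<theta> ^ n"
    by (auto dest!: bchoice)
  have "cmod (conv_power r n z) * (1 + (\<Sum>\<phi>\<in>\<Phi>. real_of_int \<bar>\<phi> z\<bar> ^ M)) \<le> (1 + sum C \<Phi>) * \<theta> ^ n" for n z
  proof -
    have "cmod (conv_power r n z) \<le> norm (op r) ^ n"
      using coeff_le[OF wl1_degree_weight_l1[OF p]] norm_op_conv_power_le[OF wl1_degree_weight_l1[OF r]]
      by (rule order_trans)
    also have "\<dots> \<le> \<theta> ^ n"
      using \<theta> by (intro power_mono) auto
    finally have "cmod (conv_power r n z) \<le> \<theta> ^ n" .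
    moreover have "cmod (conv_power r n z) * real_of_int \<bar>\<phi> z\<bar> ^ M \<le> C \<phi> * \<theta> ^ n" if \<phi>: "\<phi> \<in> \<Phi>" for \<phi>
    proof -
      have "cmod (conv_power r n z) * real_of_int \<bar>\<phi> z\<bar> ^ M = cmod (moment \<phi> M (conv_power r n) z)"
        by (simp add: moment_def norm_mult norm_power mult.commute)
      also have "\<dots> \<le> C \<phi> * \<theta> ^ n"
        by (rule order_trans[OF coeff_le[OF moment_l1[OF p \<phi> order_refl]] C[OF \<phi>]])
      finally show ?thesis .
    qed
    then have "(\<Sum>\<phi>\<in>\<Phi>. cmod (conv_power r n z) * real_of_int \<bar>\<phi> z\<bar> ^ M) \<le> (\<Sum>\<phi>\<in>\<Phi>. C \<phi> * \<theta> ^ n)"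
      by (rule sum_mono)
    ultimately show ?thesis
      by (simp add: distrib_left distrib_right sum_distrib_left sum_distrib_right)
  qed
  then show ?thesis by blast
qed

text \<open>The function \<open>h\<close> converts pointwise decay into summability:
  \<open>wh\<close> says that the weight is at most a polynomial in the coordinates times a summable
  function, and the polynomial is paid for by the decay of the powers of \<open>r\<close>.\<close>

lemma neumann_series:
  assumes r: "r \<in> wl1 (degree_weight M)" and less: "norm (op r) < 1"
    and w: "\<And>z. 1 \<le> w z" and h: "h summable_on UNIV" "\<And>z. 0 \<le> h z"
    and wh: "\<And>z. w z \<le> K * (1 + (\<Sum>\<phi>\<in>\<Phi>. real_of_int \<bar>\<phi> z\<bar> ^ M)) * h z"
  shows "\<exists>q \<in> wl1 w. op q o\<^sub>L (id_blinfun - op r) = id_blinfun"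
proof -
  \<comment> \<open>Room above the norm is needed by the recursion for the moments, room below 1 by
    the geometric series.\<close>
  obtain \<theta> where \<theta>: "norm (op r) < \<theta>" "\<theta> < 1"
    using dense[OF less] by blast
  then have \<theta>0: "0 < \<theta>"
    using norm_ge_zero[of "op r"] by linarith
  obtain C where C: "\<And>n z. cmod (conv_power r n z) * (1 + (\<Sum>\<phi>\<in>\<Phi>. real_of_int \<bar>\<phi> z\<bar> ^ M)) \<le> C * \<theta> ^ n"
    using coeff_conv_power_bound[OF r \<theta>(1)] by blast
  define D where "D = \<bar>K\<bar> * C"
  have r_l1: "r \<in> l1"
    by (rule wl1_degree_weight_l1[OF r])
  have p_l1: "conv_power r n \<in> l1" for n
    by (rule conv_power_wl1[OF r_l1, of 1]) auto
  have bound: "cmod (conv_power r n z) * w z \<le> D * h z * \<theta> ^ n" for n z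
  proof -
    let ?T = "1 + (\<Sum>\<phi>\<in>\<Phi>. real_of_int \<bar>\<phi> z\<bar> ^ M)"
    have "0 \<le> ?T"
      by (intro add_nonneg_nonneg sum_nonneg) auto
    then have "w z \<le> \<bar>K\<bar> * ?T * h z"
      by (intro order_trans[OF wh] mult_right_mono h) auto
    then have "cmod (conv_power r n z) * w z \<le> cmod (conv_power r n z) * (\<bar>K\<bar> * ?T * h z)"
      by (rule mult_left_mono) simp
    also have "\<dots> = (\<bar>K\<bar> * h z) * (cmod (conv_power r n z) * ?T)"
      by (simp add: mult_ac)
    also have "\<dots> \<le> (\<bar>K\<bar> * h z) * (C * \<theta> ^ n)"
      by (intro mult_left_mono C mult_nonneg_nonneg h) auto
    finally show ?thesis by (simp add: D_def mult_ac)
  qed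
  have bound1: "cmod (conv_power r n z) \<le> D * h z * \<theta> ^ n" for n z
    using order_trans[OF mult_left_mono[OF w[of z], of "cmod (conv_power r n z)"] bound[of n z]] by simp
  have geo: "summable (\<lambda>n. D * h z * \<theta> ^ n)" for z
    using \<theta> \<theta>0 by (intro summable_mult summable_geometric) simp
  have sn: "summable (\<lambda>n. cmod (conv_power r n z))" for z
    by (rule summable_comparison_test'[OF geo[of z]]) (simp add: bound1)
  define q where "q z = (\<Sum>n. conv_power r n z)" for z
  \<comment> \<open>One estimate serves twice: \<open>k = 0\<close> places \<open>q\<close> in
    \<open>wl1 w\<close>, and general \<open>k\<close>, with \<open>w \<ge> 1\<close>, makes the
    partial sums converge to \<open>op q\<close> in operator norm.\<close>
  have tail: "cmod (q z - (\<Sum>n<k. conv_power r n z)) * w z \<le> D / (1 - \<theta>) * \<theta> ^ k * h z" for z k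
  proof -
    have w0: "0 \<le> w z"
      using w[of z] by simp
    have sk: "summable (\<lambda>n. cmod (conv_power r (n + k) z))"
      using sn[of z] by (simp add: summable_iff_shift[of "\<lambda>n. cmod (conv_power r n z)"])
    have "q z - (\<Sum>n<k. conv_power r n z) = (\<Sum>n. conv_power r (n + k) z)"
      unfolding q_def by (rule suminf_minus_initial_segment[OF summable_norm_cancel[OF sn], symmetric])
    then have "cmod (q z - (\<Sum>n<k. conv_power r n z)) * w z \<le> (\<Sum>n. cmod (conv_power r (n + k) z)) * w z"
      using w0 by (simp only:) (intro mult_right_mono summable_norm sk)
    also have "\<dots> = (\<Sum>n. cmod (conv_power r (n + k) z) * w z)"
      by (rule suminf_mult2[OF sk])
    also have "\<dots> \<le> (\<Sum>n. D * h z * \<theta> ^ k * \<theta> ^ n)"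
    proof (rule suminf_le)
      show "cmod (conv_power r (n + k) z) * w z \<le> D * h z * \<theta> ^ k * \<theta> ^ n" for n
        using bound[of "n + k" z] by (simp add: power_add mult_ac)
      show "summable (\<lambda>n. cmod (conv_power r (n + k) z) * w z)"
        by (rule summable_mult2[OF sk])
      show "summable (\<lambda>n. D * h z * \<theta> ^ k * \<theta> ^ n)"
        using \<theta> \<theta>0 by (intro summable_mult summable_geometric) simp
    qed
    also have "\<dots> = D * h z * \<theta> ^ k * (1 / (1 - \<theta>))"
      using \<theta> \<theta>0 by (subst suminf_mult) (simp_all add: suminf_geometric summable_geometric)
    finally show ?thesis by (simp add: mult_ac)
  qed
  have h_wl1: "(\<lambda>z. complex_of_real (h z)) \<in> l1"
    using h by (simp add: wl1_def)
  have q: "q \<in> wl1 w"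
  proof (rule wl1_comparison[OF h_wl1, where C = "D / (1 - \<theta>)"])
    show "cmod (q z) * w z \<le> D / (1 - \<theta>) * (cmod (complex_of_real (h z)) * 1)" for z
      using tail[of z 0] by (simp add: h(2))
    show "0 \<le> w z" for z using w[of z] by simp
  qed
  have q_l1: "q \<in> l1"
    by (rule wl1_mono[OF q, where C = 1]) (auto simp: w)
  define S where "S k z = (\<Sum>n<k. conv_power r n z)" for k z
  have S: "S k \<in> l1" "op (S k) = (\<Sum>n<k. op (conv_power r n))" for k
    unfolding S_def using op_sum[of "{..<k}" "conv_power r"] p_l1 by auto
  \<comment> \<open>The product telescopes because \<open>conv_power\<close> multiplies by
    \<open>r\<close> on the right, the side on which the factor stands here.\<close>
  have tel: "op (S k) o\<^sub>L (id_blinfun - op r) = id_blinfun - op (conv_power r k)" for k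
  proof (induct k)
    case 0
    then show ?case
      by (simp add: S(2) op_delta u_0)
  next
    case (Suc k)
    have "op (S (Suc k)) o\<^sub>L (id_blinfun - op r) =
      (op (S k) o\<^sub>L (id_blinfun - op r)) + (op (conv_power r k) o\<^sub>L (id_blinfun - op r))"
      by (simp add: S(2) bounded_bilinear.add_left[OF bounded_bilinear_blinfun_compose])
    also have "op (conv_power r k) o\<^sub>L (id_blinfun - op r) = op (conv_power r k) - op (conv_power r (Suc k))"
      by (simp only: bounded_bilinear.diff_right[OF bounded_bilinear_blinfun_compose] blinfun_compose_id
          op_conv_power_Suc[OF r_l1])
    finally show ?case
      by (simp only: Suc) simp
  qed
  have \<theta>_lim: "(\<lambda>k. \<theta> ^ k) \<longlonglongrightarrow> 0"
    using \<theta> \<theta>0 by (intro LIMSEQ_power_zero) simp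
  have "norm (op q - op (S k)) \<le> D / (1 - \<theta>) * infsum h UNIV * \<theta> ^ k" for k
  proof -
    have neg: "(\<lambda>z. - 1 * S k z) \<in> l1"
      by (rule wl1_cmult[OF S(1)])
    have "op (\<lambda>z. q z + - 1 * S k z) = op q - op (S k)"
      using op_add[OF q_l1 neg] op_cmult[OF S(1), of "- 1" k] cscale_op_of_real[of "- 1" "op (S k)"] by simp
    then have "norm (op q - op (S k)) \<le> (\<Sum>\<^sub>\<infinity>z. cmod (q z + - 1 * S k z))"
      using norm_op_le[OF wl1_add[OF q_l1 neg]] by simp
    also have "\<dots> \<le> (\<Sum>\<^sub>\<infinity>z. D / (1 - \<theta>) * \<theta> ^ k * h z)"
    proof (rule infsum_mono)
      show "(\<lambda>z. cmod (q z + - 1 * S k z)) summable_on UNIV"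
        using wl1_add[OF q_l1 neg] by (simp add: wl1_def)
      show "(\<lambda>z. D / (1 - \<theta>) * \<theta> ^ k * h z) summable_on UNIV"
        by (intro summable_on_cmult_right h)
      show "cmod (q z + - 1 * S k z) \<le> D / (1 - \<theta>) * \<theta> ^ k * h z" for z
        using order_trans[OF mult_left_mono[OF w[of z], of "cmod (q z - S k z)"] tail[of z k, folded S_def]]
        by simp
    qed
    also have "\<dots> = D / (1 - \<theta>) * \<theta> ^ k * infsum h UNIV"
      by (intro infsum_cmult_right h)
    finally show ?thesis by (simp add: mult_ac)
  qed
  moreover have "(\<lambda>k. D / (1 - \<theta>) * infsum h UNIV * \<theta> ^ k) \<longlonglongrightarrow> 0"
    by (rule tendsto_mult_right_zero[OF \<theta>_lim])
  ultimately have "(\<lambda>k. op q - op (S k)) \<longlonglongrightarrow> 0"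
    by (rule Lim_null_comparison[OF always_eventually[OF allI]])
  then have "(\<lambda>k. op q - (op q - op (S k))) \<longlonglongrightarrow> op q - 0"
    by (intro tendsto_diff tendsto_const)
  then have "(\<lambda>k. op (S k)) \<longlonglongrightarrow> op q"
    by simp
  then have "(\<lambda>k. op (S k) o\<^sub>L (id_blinfun - op r)) \<longlonglongrightarrow> (op q o\<^sub>L (id_blinfun - op r))"
    by (intro bounded_bilinear.tendsto[OF bounded_bilinear_blinfun_compose] tendsto_const)
  then have lim1: "(\<lambda>k. id_blinfun - op (conv_power r k)) \<longlonglongrightarrow> (op q o\<^sub>L (id_blinfun - op r))"
    by (simp only: tel)
  have "norm (op (conv_power r k)) \<le> \<theta> ^ k" for k
    by (rule order_trans[OF norm_op_conv_power_le[OF r_l1] power_mono]) (use \<theta> in auto)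
  then have "(\<lambda>k. op (conv_power r k)) \<longlonglongrightarrow> 0"
    by (intro Lim_null_comparison[OF _ \<theta>_lim] always_eventually allI)
  then have "(\<lambda>k. id_blinfun - op (conv_power r k)) \<longlonglongrightarrow> id_blinfun - 0"
    by (intro tendsto_diff tendsto_const)
  then have "op q o\<^sub>L (id_blinfun - op r) = id_blinfun"
    using LIMSEQ_unique[OF lim1] by simp
  then show ?thesis
    using q by blast
qed

text \<open>Two weights occur. \<open>degree_weight M\<close> is the regularity of \<open>a\<close>
  spent on the moments of \<open>r\<close>; \<open>w\<close> is the weight that the coefficients of
  the inverse retain. Evenness of \<open>w\<close> carries it through \<open>star\<close>, and
  submultiplicativity through the final product.\<close>

lemma inverse_wl1:
  assumes a: "a \<in> wl1 (degree_weight M)" "a \<in> wl1 w"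
    and w: "\<And>z. 1 \<le> w z" "\<And>z. w (- z) = w z" "\<And>y z. w (y + z) \<le> K' * w y * w z"
    and h: "h summable_on UNIV" "\<And>z. 0 \<le> h z"
    and wh: "\<And>z. w z \<le> K * (1 + (\<Sum>\<phi>\<in>\<Phi>. real_of_int \<bar>\<phi> z\<bar> ^ M)) * h z"
    and inv: "op a o\<^sub>L B = id_blinfun" "B o\<^sub>L op a = id_blinfun"
  shows "\<exists>b \<in> wl1 w. B = op b"
proof -
  have w0: "0 \<le> w z" for z using w(1)[of z] by simp
  have a_l1: "a \<in> l1"
    by (rule wl1_degree_weight_l1[OF a(1)])
  have s: "star a \<in> wl1 (degree_weight M)" "star a \<in> wl1 w"
    by (intro star_wl1 a degree_weight_minus w)+
  have s_l1: "star a \<in> l1"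
    by (rule wl1_degree_weight_l1[OF s(1)])
  obtain l where l: "0 < l" "norm (id_blinfun - l *\<^sub>R (op (star a) o\<^sub>L op a)) < 1"
    using norm_id_minus_adjoint_compose_less_1[OF is_adjoint_op_star[OF a_l1] inv(2)] by blast
  define r where "r z = (if z = 0 then 1 else 0) + complex_of_real (- l) * conv (star a) a z" for z
  have r: "r \<in> wl1 (degree_weight M)"
    unfolding r_def
    by (intro wl1_add wl1_delta wl1_cmult conv_wl1[OF s(1) a(1) degree_weight_nonneg degree_weight_submult]
        degree_weight_nonneg)
  have "op r = id_blinfun + (- l) *\<^sub>R (op (star a) o\<^sub>L op a)"
    unfolding r_def
    by (subst op_add[OF wl1_delta wl1_cmult[OF conv_l1[OF s_l1 a_l1]]])
      (simp only: op_delta u_0 cscale_op_1 op_cmult[OF conv_l1[OF s_l1 a_l1]] cscale_op_of_real op_conv[OF s_l1 a_l1])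
  then have op_r: "op r = id_blinfun - l *\<^sub>R (op (star a) o\<^sub>L op a)"
    by simp
  then obtain q where q: "q \<in> wl1 w" "op q o\<^sub>L (id_blinfun - op r) = id_blinfun"
    using neumann_series[OF r _ w(1) h wh] l(2) by auto
  have q_l1: "q \<in> l1"
    by (rule wl1_mono[OF q(1), where C = 1]) (auto simp: w)
  have "id_blinfun - op r = l *\<^sub>R (op (star a) o\<^sub>L op a)"
    by (simp add: op_r)
  \<comment> \<open>Multiplying by \<open>B\<close> on the right cancels \<open>op a\<close>, so a
    one-sided inverse of the positive operator already determines \<open>B\<close>.\<close>
  then have "(op q o\<^sub>L (l *\<^sub>R (op (star a) o\<^sub>L op a))) o\<^sub>L B = id_blinfun o\<^sub>L B"
    using q(2) by simp
  then have "B = (op q o\<^sub>L (l *\<^sub>R (op (star a) o\<^sub>L op a))) o\<^sub>L B"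
    by simp
  also have "\<dots> = l *\<^sub>R (op q o\<^sub>L op (star a))"
  proof (rule blinfun_eqI)
    fix f
    have "op a (B f) = f"
      by (metis blinfun_apply_blinfun_compose blinfun_apply_id_blinfun inv(1))
    then show "((op q o\<^sub>L (l *\<^sub>R (op (star a) o\<^sub>L op a))) o\<^sub>L B) f = (l *\<^sub>R (op q o\<^sub>L op (star a))) f"
      by (simp add: blinfun.scaleR_left blinfun.scaleR_right)
  qed
  also have "\<dots> = op (\<lambda>z. complex_of_real l * conv q (star a) z)"
    by (simp only: op_cmult[OF conv_l1[OF q_l1 s_l1]] cscale_op_of_real op_conv[OF q_l1 s_l1])
  finally have "B = op (\<lambda>z. complex_of_real l * conv q (star a) z)" .
  moreover have "(\<lambda>z. complex_of_real l * conv q (star a) z) \<in> wl1 w"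
    by (intro wl1_cmult conv_wl1[OF q(1) s(2) w0 w(3)])
  ultimately show ?thesis by blast
qed

end

section \<open>The lattice of time-frequency shifts\<close>

lemma real_vec_add: "real_vec (k + l) = real_vec k + real_vec l"
  by (simp add: real_vec_def vec_eq_iff)

lemma real_vec_uminus: "real_vec (- k) = - real_vec k"
  by (simp add: real_vec_def vec_eq_iff)

lemma real_vec_0: "real_vec 0 = 0"
  by (simp add: real_vec_def vec_eq_iff)

lemma norm_real_vec: "(norm (real_vec k))\<^sup>2 = (\<Sum>j\<in>UNIV. (real_of_int (k $ j))\<^sup>2)"
  unfolding power2_norm_eq_inner inner_vec_def by (simp add: real_vec_def power2_eq_square)

lemma summable_on_int_inverse_square: "(\<lambda>n :: int. 1 / (1 + (real_of_int n)\<^sup>2)) summable_on UNIV"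
proof -
  let ?f = "\<lambda>n :: int. 1 / (1 + (real_of_int n)\<^sup>2)"
  have "summable (\<lambda>n :: nat. norm (1 / (1 + (real n)\<^sup>2)))"
  proof (rule summable_comparison_test')
    show "summable (\<lambda>n :: nat. inverse ((real n)\<^sup>2))"
      by (rule inverse_power_summable) simp
    show "norm (norm (1 / (1 + (real n)\<^sup>2))) \<le> inverse ((real n)\<^sup>2)" if "1 \<le> n" for n
      using that by (simp add: field_simps add_pos_nonneg)
  qed
  then have *: "(\<lambda>n :: nat. 1 / (1 + (real n)\<^sup>2)) summable_on UNIV"
    by (rule norm_summable_imp_summable_on)
  have "?f summable_on range int"
    by (subst summable_on_reindex) (use * in \<open>auto simp: o_def\<close>)
  moreover have "?f summable_on range (\<lambda>n. - int n)"
    by (subst summable_on_reindex) (use * in \<open>auto simp: o_def inj_on_def\<close>)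
  ultimately have "?f summable_on range int \<union> range (\<lambda>n. - int n)"
    by (rule summable_on_union)
  moreover have "range int \<union> range (\<lambda>n. - int n) = UNIV"
    using int_cases2 by (auto simp: image_def) metis
  ultimately show ?thesis by simp
qed

text \<open>Every finite set of vectors lies in a box over the finite set of all their entries, and
  over a box the sum of products factors into a product of one-dimensional sums.\<close>

lemma summable_on_vec_prod:
  fixes f :: "'b \<Rightarrow> real"
  assumes f: "f summable_on UNIV" "\<And>x. 0 \<le> f x"
  shows "(\<lambda>v :: 'b ^ 'd. \<Prod>j\<in>UNIV. f (v $ j)) summable_on UNIV"
proof (rule nonneg_bdd_above_summable_on)
  show "bdd_above (sum (\<lambda>v :: 'b ^ 'd. \<Prod>j\<in>UNIV. f (v $ j)) ` {F. F \<subseteq> UNIV \<and> finite F})"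
  proof (rule bdd_aboveI2)
    fix F :: "('b ^ 'd) set" assume "F \<in> {F. F \<subseteq> UNIV \<and> finite F}"
    then have F: "finite F" by simp
    define B where "B = (\<Union>v\<in>F. range (vec_nth v))"
    have B: "finite B"
      using F by (simp add: B_def)
    have "sum (\<lambda>v. \<Prod>j\<in>UNIV. f (v $ j)) F = sum (\<lambda>g. \<Prod>j\<in>UNIV. f (g j)) (vec_nth ` F)"
      by (subst sum.reindex) (auto simp: inj_on_def vec_nth_inject)
    also have "\<dots> \<le> sum (\<lambda>g. \<Prod>j\<in>UNIV. f (g j)) (PiE (UNIV :: 'd set) (\<lambda>_. B))"
    proof (rule sum_mono2)
      show "finite (PiE (UNIV :: 'd set) (\<lambda>_. B))"
        by (intro finite_PiE B) simp
      show "vec_nth ` F \<subseteq> PiE (UNIV :: 'd set) (\<lambda>_. B)"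
        by (auto simp: B_def)
    qed (simp add: f prod_nonneg)
    also have "\<dots> = (\<Prod>j\<in>(UNIV :: 'd set). sum f B)"
      by (rule prod_sum_PiE[symmetric]) (simp_all add: B)
    also have "\<dots> \<le> (\<Prod>j\<in>(UNIV :: 'd set). infsum f UNIV)"
      by (intro prod_mono conjI sum_nonneg finite_sum_le_infsum f B) auto
    finally show "sum (\<lambda>v. \<Prod>j\<in>UNIV. f (v $ j)) F \<le> (\<Prod>j\<in>(UNIV :: 'd set). infsum f UNIV)" .
  qed
qed (simp add: f prod_nonneg)

definition lattice_shift :: "real \<Rightarrow> real \<Rightarrow> (int ^ 'd) \<times> (int ^ 'd) \<Rightarrow> (real ^ 'd) L2_op" where
  "lattice_shift \<alpha> \<beta> = (\<lambda>(k, l). tf_shift (\<alpha> *\<^sub>R real_vec k) (\<beta> *\<^sub>R real_vec l))"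

text \<open>The phase of \<open>tf_shift_compose\<close> at lattice points. On the diagonal it is
  the phase of \<open>is_adjoint_tf_shift\<close>, so it also supplies the function \<eta> of the
  locale.\<close>

definition lattice_cocycle :: "real \<Rightarrow> real \<Rightarrow> (int ^ 'd) \<times> (int ^ 'd) \<Rightarrow> (int ^ 'd) \<times> (int ^ 'd) \<Rightarrow> complex" where
  "lattice_cocycle \<alpha> \<beta> y z = exp (- (2 * complex_of_real pi * \<i> *
     complex_of_real ((\<beta> *\<^sub>R real_vec (snd z)) \<bullet> (\<alpha> *\<^sub>R real_vec (fst y)))))"

definition lattice_coordinates :: "((int ^ 'd) \<times> (int ^ 'd) \<Rightarrow> int) set" where
  "lattice_coordinates = range (\<lambda>j z. fst z $ j) \<union> range (\<lambda>j z. snd z $ j)"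

definition lattice_weight :: "real \<Rightarrow> real \<Rightarrow> real \<Rightarrow> (int ^ 'd) \<times> (int ^ 'd) \<Rightarrow> real" where
  "lattice_weight \<alpha> \<beta> s z =
     (1 + \<alpha>\<^sup>2 * (norm (real_vec (fst z)))\<^sup>2 + \<beta>\<^sup>2 * (norm (real_vec (snd z)))\<^sup>2) powr (s / 2)"

lemma twisted_rep_lattice:
  "twisted_rep (lattice_shift \<alpha> \<beta>) (lattice_cocycle \<alpha> \<beta>) (\<lambda>z. lattice_cocycle \<alpha> \<beta> z z)"
proof
  fix y z :: "(int ^ 'd) \<times> (int ^ 'd)"
  show "lattice_shift \<alpha> \<beta> z \<in> bounded_ops"
    by (simp add: lattice_shift_def case_prod_unfold)
  show "norm (lattice_shift \<alpha> \<beta> z) \<le> 1"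
    by (simp add: lattice_shift_def case_prod_unfold norm_tf_shift)
  show "lattice_shift \<alpha> \<beta> (0 :: (int ^ 'd) \<times> (int ^ 'd)) = id_blinfun"
    by (simp add: lattice_shift_def case_prod_unfold real_vec_0 tf_shift_0)
  show "lattice_shift \<alpha> \<beta> y o\<^sub>L lattice_shift \<alpha> \<beta> z =
      cscale_op (lattice_cocycle \<alpha> \<beta> y z) (lattice_shift \<alpha> \<beta> (y + z))"
    by (simp only: lattice_shift_def lattice_cocycle_def case_prod_unfold tf_shift_compose
        fst_add snd_add real_vec_add scaleR_add_right)
  show "cmod (lattice_cocycle \<alpha> \<beta> y z) = 1" "cmod (lattice_cocycle \<alpha> \<beta> z z) = 1"
    by (simp_all add: lattice_cocycle_def)
  show "is_adjoint (lattice_shift \<alpha> \<beta> z)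
      (cscale_op (lattice_cocycle \<alpha> \<beta> z z) (lattice_shift \<alpha> \<beta> (- z)))"
    unfolding lattice_shift_def lattice_cocycle_def case_prod_unfold fst_uminus snd_uminus
      real_vec_uminus scaleR_minus_right
    by (rule is_adjoint_tf_shift)
qed

text \<open>The exponent is the symplectic form of the two phase-space points. Orthogonality of
  \<eta> and \<open>y\<close> makes \<open>tf_shift (- y) (- \<eta>)\<close> the exact inverse of
  the conjugating shift, with no phase left over.\<close>

lemma conjugate_tf_shift:
  assumes "\<eta> \<bullet> y = 0"
  shows "tf_shift y \<eta> o\<^sub>L tf_shift x \<omega> o\<^sub>L tf_shift (- y) (- \<eta>) =
    cscale_op (exp (2 * complex_of_real pi * \<i> * complex_of_real (\<eta> \<bullet> x - \<omega> \<bullet> y))) (tf_shift x \<omega>)"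
proof -
  have "- (2 * complex_of_real pi * \<i> * complex_of_real (\<omega> \<bullet> y)) +
      - (2 * complex_of_real pi * \<i> * complex_of_real ((- \<eta>) \<bullet> (y + x))) =
      2 * complex_of_real pi * \<i> * complex_of_real (\<eta> \<bullet> x - \<omega> \<bullet> y)"
    using assms by (simp add: inner_add_right ring_distribs)
  then show ?thesis
    by (simp only: tf_shift_compose cscale_op_compose_left cscale_op_cscale_op exp_add[symmetric])
      (simp add: add.commute)
qed

text \<open>Any irrational \<open>t\<close> will do, and one exists because the rationals are
  countable.\<close>

lemma ex_unimodular_infinite_order:
  "\<exists>t :: real. \<forall>n :: int. n \<noteq> 0 \<longrightarrow> exp (2 * complex_of_real pi * \<i> * complex_of_real t) powi n \<noteq> 1"
proof -
  obtain t :: real where t: "t \<notin> \<rat>"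
    using uncountable_UNIV_real countable_rat by (metis UNIV_eq_I)
  have "exp (2 * complex_of_real pi * \<i> * complex_of_real t) powi n \<noteq> 1" if "n \<noteq> 0" for n
  proof
    assume "exp (2 * complex_of_real pi * \<i> * complex_of_real t) powi n = 1"
    then obtain m :: int where "real_of_int n * (2 * pi * t) = real_of_int (2 * m) * pi"
      by (auto simp: exp_power_int exp_eq_1)
    then have "t = real_of_int m / real_of_int n"
      using that by (simp add: field_simps)
    then show False
      using t by simp
  qed
  then show ?thesis by blast
qed

lemma graded_rep_lattice:
  assumes "\<alpha> > 0" "\<beta> > 0"
  shows "graded_rep (lattice_shift \<alpha> \<beta>) (lattice_cocycle \<alpha> \<beta>) (\<lambda>z. lattice_cocycle \<alpha> \<beta> z z)
    (lattice_coordinates :: ((int ^ 'd) \<times> (int ^ 'd) \<Rightarrow> int) set)"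
proof (intro graded_rep.intro twisted_rep_lattice graded_rep_axioms.intro)
  show "finite (lattice_coordinates :: ((int ^ 'd) \<times> (int ^ 'd) \<Rightarrow> int) set)"
    by (simp add: lattice_coordinates_def)
next
  fix \<phi> :: "(int ^ 'd) \<times> (int ^ 'd) \<Rightarrow> int" and y z :: "(int ^ 'd) \<times> (int ^ 'd)"
  assume "\<phi> \<in> lattice_coordinates"
  then show "\<phi> (y + z) = \<phi> y + \<phi> z"
    by (auto simp: lattice_coordinates_def)
next
  fix z :: "(int ^ 'd) \<times> (int ^ 'd)"
  assume *: "\<phi> z = 0" if "\<phi> \<in> lattice_coordinates" for \<phi>
  have "fst z $ j = 0" "snd z $ j = 0" for j
    using *[of "\<lambda>z. fst z $ j"] *[of "\<lambda>z. snd z $ j"] by (auto simp: lattice_coordinates_def)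
  then show "z = 0"
    by (auto simp: prod_eq_iff vec_eq_iff)
next
  fix \<phi> :: "(int ^ 'd) \<times> (int ^ 'd) \<Rightarrow> int"
  assume \<phi>: "\<phi> \<in> lattice_coordinates"
  obtain t :: real where t: "\<And>n :: int. n \<noteq> 0 \<Longrightarrow> exp (2 * complex_of_real pi * \<i> * complex_of_real t) powi n \<noteq> 1"
    using ex_unimodular_infinite_order by blast
  let ?\<zeta> = "exp (2 * complex_of_real pi * \<i> * complex_of_real t)"
  have power: "?\<zeta> powi n = exp (2 * complex_of_real pi * \<i> * complex_of_real (t * real_of_int n))" for n
    by (simp add: exp_power_int mult_ac)
  \<comment> \<open>A coordinate of the translation index is detected by a pure modulation of size
    \<open>t / \<alpha>\<close>, one of the modulation index by a pure translation of size
    \<open>- t / \<beta>\<close>. These steps make the angle the irrational \<open>t\<close>,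
    whatever the value of \<alpha> \<beta>.\<close>
  obtain y \<eta> :: "real ^ 'd" where "\<eta> \<bullet> y = 0"
    and dual: "\<And>z. \<eta> \<bullet> (\<alpha> *\<^sub>R real_vec (fst z)) - (\<beta> *\<^sub>R real_vec (snd z)) \<bullet> y = t * real_of_int (\<phi> z)"
  proof -
    consider j where "\<phi> = (\<lambda>z. fst z $ j)" | j where "\<phi> = (\<lambda>z. snd z $ j)"
      using \<phi> by (auto simp: lattice_coordinates_def)
    then show thesis
    proof cases
      case 1
      show thesis
        by (rule that[of "axis j (t / \<alpha>)" 0])
          (use assms in \<open>simp_all add: 1 inner_axis' real_vec_def\<close>)
    next
      case 2
      show thesis
        by (rule that[of 0 "axis j (- t / \<beta>)"])
          (use assms in \<open>simp_all add: 2 inner_axis real_vec_def\<close>)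
    qed
  qed
  then have conj: "tf_shift y \<eta> o\<^sub>L lattice_shift \<alpha> \<beta> z o\<^sub>L tf_shift (- y) (- \<eta>) =
      cscale_op (?\<zeta> powi \<phi> z) (lattice_shift \<alpha> \<beta> z)" for z
    by (simp only: lattice_shift_def case_prod_unfold conjugate_tf_shift power)
  have unimodular: "cmod ?\<zeta> = 1"
    by simp
  show "\<exists>V V' \<zeta>. V \<in> bounded_ops \<and> norm V \<le> 1 \<and> norm V' \<le> 1 \<and> cmod \<zeta> = 1 \<and>
      (\<forall>n. n \<noteq> 0 \<longrightarrow> \<zeta> powi n \<noteq> 1) \<and>
      (\<forall>z. V o\<^sub>L lattice_shift \<alpha> \<beta> z o\<^sub>L V' = cscale_op (\<zeta> powi \<phi> z) (lattice_shift \<alpha> \<beta> z))"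
    by (intro exI[of _ "tf_shift y \<eta>"] exI[of _ "tf_shift (- y) (- \<eta>)"] exI[of _ ?\<zeta>] conjI allI impI
        t conj unimodular norm_tf_shift tf_shift_in_bounded_ops)
qed

section \<open>Comparison of polynomial weights on the lattice\<close>

lemma lattice_weight_base_ge:
  "1 \<le> 1 + \<alpha>\<^sup>2 * (norm (real_vec k))\<^sup>2 + \<beta>\<^sup>2 * (norm (real_vec l))\<^sup>2"
  by simp

lemma lattice_weight_ge_1: "0 \<le> s \<Longrightarrow> 1 \<le> lattice_weight \<alpha> \<beta> s z"
  unfolding lattice_weight_def by (intro ge_one_powr_ge_zero) auto

lemma lattice_weight_mono: "s \<le> s' \<Longrightarrow> lattice_weight \<alpha> \<beta> s z \<le> lattice_weight \<alpha> \<beta> s' z"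
  unfolding lattice_weight_def by (intro powr_mono) auto

lemma lattice_weight_nonneg: "0 \<le> lattice_weight \<alpha> \<beta> s z"
  unfolding lattice_weight_def by simp

lemma lattice_weight_minus: "lattice_weight \<alpha> \<beta> s (- z) = lattice_weight \<alpha> \<beta> s z"
  by (simp add: lattice_weight_def real_vec_uminus)

text \<open>The bound |a + b|^2 \<le> 2 |a|^2 + 2 |b|^2 makes the base of the weight
  submultiplicative up to the factor 2; raising it to the power \<open>s / 2\<close> gives the
  constant.\<close>

lemma lattice_weight_submult:
  assumes "0 \<le> s"
  shows "lattice_weight \<alpha> \<beta> s (y + z) \<le> 2 powr (s / 2) * lattice_weight \<alpha> \<beta> s y * lattice_weight \<alpha> \<beta> s z"
proof -
  let ?T = "\<lambda>z. 1 + \<alpha>\<^sup>2 * (norm (real_vec (fst z)))\<^sup>2 + \<beta>\<^sup>2 * (norm (real_vec (snd z)))\<^sup>2"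
  have T: "0 \<le> ?T z" for z :: "(int ^ 'd) \<times> (int ^ 'd)"
    by simp
  have sq: "(norm (a + b))\<^sup>2 \<le> 2 * (norm a)\<^sup>2 + 2 * (norm b)\<^sup>2" for a b :: "real ^ 'd"
  proof -
    have "(norm (a + b))\<^sup>2 \<le> (norm a + norm b)\<^sup>2"
      by (intro power_mono norm_triangle_ineq) simp
    also have "\<dots> \<le> 2 * (norm a)\<^sup>2 + 2 * (norm b)\<^sup>2"
      using zero_le_power2[of "norm a - norm b"] by (simp add: power2_sum power2_diff)
    finally show ?thesis .
  qed
  let ?P = "\<lambda>z. \<alpha>\<^sup>2 * (norm (real_vec (fst z)))\<^sup>2 + \<beta>\<^sup>2 * (norm (real_vec (snd z)))\<^sup>2"
  have P: "0 \<le> ?P z" for z :: "(int ^ 'd) \<times> (int ^ 'd)"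
    by simp
  have "\<alpha>\<^sup>2 * (norm (real_vec (fst (y + z))))\<^sup>2 \<le>
      \<alpha>\<^sup>2 * (2 * (norm (real_vec (fst y)))\<^sup>2 + 2 * (norm (real_vec (fst z)))\<^sup>2)"
    unfolding fst_add real_vec_add by (intro mult_left_mono sq) simp
  moreover have "\<beta>\<^sup>2 * (norm (real_vec (snd (y + z))))\<^sup>2 \<le>
      \<beta>\<^sup>2 * (2 * (norm (real_vec (snd y)))\<^sup>2 + 2 * (norm (real_vec (snd z)))\<^sup>2)"
    unfolding snd_add real_vec_add by (intro mult_left_mono sq) simp
  ultimately have "?P (y + z) \<le> 2 * ?P y + 2 * ?P z"
    by (simp add: distrib_left)
  moreover have "0 \<le> ?P y * ?P z"
    by (intro mult_nonneg_nonneg P)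
  moreover have "2 * (1 + ?P y) * (1 + ?P z) = 2 + 2 * ?P y + 2 * ?P z + 2 * (?P y * ?P z)"
    by (simp only: distrib_left distrib_right)
  ultimately have "1 + ?P (y + z) \<le> 2 * (1 + ?P y) * (1 + ?P z)"
    by linarith
  then have "?T (y + z) \<le> 2 * ?T y * ?T z"
    by (simp only: add.assoc)
  then have "?T (y + z) powr (s / 2) \<le> (2 * ?T y * ?T z) powr (s / 2)"
    using assms T by (intro powr_mono2) auto
  also have "\<dots> = 2 powr (s / 2) * ?T y powr (s / 2) * ?T z powr (s / 2)"
    using T by (simp only: powr_mult)
  finally show ?thesis
    by (simp only: lattice_weight_def)
qed

text \<open>This is the summable function \<open>h\<close> of \<open>neumann_series\<close>; the
  product form reduces its summability to a single sum over the integers.\<close>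

definition lattice_decay :: "(int ^ 'd) \<times> (int ^ 'd) \<Rightarrow> real" where
  "lattice_decay z = (\<Prod>j\<in>UNIV. 1 / (1 + (real_of_int (fst z $ j))\<^sup>2)) *
     (\<Prod>j\<in>UNIV. 1 / (1 + (real_of_int (snd z $ j))\<^sup>2))"

lemma lattice_decay_pos: "0 < lattice_decay z"
  unfolding lattice_decay_def by (intro mult_pos_pos prod_pos) (auto intro!: add_pos_nonneg)

lemma lattice_decay_summable: "(lattice_decay :: (int ^ 'd) \<times> (int ^ 'd) \<Rightarrow> real) summable_on UNIV"
proof -
  have s: "(\<lambda>k :: int ^ 'd. \<Prod>j\<in>UNIV. 1 / (1 + (real_of_int (k $ j))\<^sup>2)) summable_on UNIV"
    by (rule summable_on_vec_prod[OF summable_on_int_inverse_square]) simp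
  have "lattice_decay = (\<lambda>(k :: int ^ 'd, l :: int ^ 'd).
      (\<Prod>j\<in>UNIV. 1 / (1 + (real_of_int (k $ j))\<^sup>2)) * (\<Prod>j\<in>UNIV. 1 / (1 + (real_of_int (l $ j))\<^sup>2)))"
    by (simp add: fun_eq_iff lattice_decay_def)
  then show ?thesis
    using summable_on_product[OF s s] by (simp add: prod_nonneg)
qed

text \<open>All quantities are compared with the largest coordinate \<open>t\<close> of the lattice point.\<close>

lemma lattice_weight_le_coordinates:
  "\<exists>M K. \<forall>z :: (int ^ 'd) \<times> (int ^ 'd). lattice_weight \<alpha> \<beta> s z \<le>
     K * (1 + (\<Sum>\<phi>\<in>lattice_coordinates. real_of_int \<bar>\<phi> z\<bar> ^ M)) * lattice_decay z"
proof -
  define d where "d = CARD('d)"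
  \<comment> \<open>The base of the weight is at most \<open>c * (1 + t\<^sup>2)\<close>. Of the
    exponent \<open>n\<close> below, \<open>N\<close> rounds \<open>s / 2\<close> up and pays for
    the weight, while \<open>d + d\<close> pays for one factor \<open>1 + t\<^sup>2\<close> per
    coordinate in \<open>lattice_decay\<close>; since \<open>t\<close> enters squared, moments of
    order \<open>2 * n\<close> result.\<close>
  define c where "c = 1 + (\<alpha>\<^sup>2 + \<beta>\<^sup>2) * real d"
  define N where "N = nat \<lceil>s / 2\<rceil>"
  define n where "n = N + (d + d)"
  have c: "1 \<le> c" by (simp add: c_def)
  have "lattice_weight \<alpha> \<beta> s z \<le>
      c ^ N * 2 ^ n * (1 + (\<Sum>\<phi>\<in>lattice_coordinates. real_of_int \<bar>\<phi> z\<bar> ^ (2 * n))) * lattice_decay z"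
    for z :: "(int ^ 'd) \<times> (int ^ 'd)"
  proof -
    let ?\<Phi> = "lattice_coordinates :: ((int ^ 'd) \<times> (int ^ 'd) \<Rightarrow> int) set"
    have fin: "finite ?\<Phi>" and ne: "?\<Phi> \<noteq> {}"
      by (auto simp: lattice_coordinates_def)
    have "Max ((\<lambda>\<phi>. real_of_int \<bar>\<phi> z\<bar>) ` ?\<Phi>) \<in> (\<lambda>\<phi>. real_of_int \<bar>\<phi> z\<bar>) ` ?\<Phi>"
      using fin ne by (intro Max_in) auto
    then obtain \<psi> where \<psi>: "\<psi> \<in> ?\<Phi>" "Max ((\<lambda>\<phi>. real_of_int \<bar>\<phi> z\<bar>) ` ?\<Phi>) = real_of_int \<bar>\<psi> z\<bar>"
      by auto
    define t where "t = real_of_int \<bar>\<psi> z\<bar>"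
    have t0: "0 \<le> t"
      by (simp add: t_def)
    have t: "real_of_int \<bar>\<phi> z\<bar> \<le> t" if "\<phi> \<in> ?\<Phi>" for \<phi>
      unfolding t_def \<psi>(2)[symmetric] by (intro Max_ge finite_imageI fin imageI that)
    have sq: "(real_of_int (fst z $ j))\<^sup>2 \<le> t\<^sup>2" "(real_of_int (snd z $ j))\<^sup>2 \<le> t\<^sup>2" for j
      using t[of "\<lambda>z. fst z $ j"] t[of "\<lambda>z. snd z $ j"] t0
      by (auto simp: lattice_coordinates_def intro!: abs_le_square_iff[THEN iffD1])
    have norms: "(norm (real_vec (fst z)))\<^sup>2 \<le> real d * t\<^sup>2" "(norm (real_vec (snd z)))\<^sup>2 \<le> real d * t\<^sup>2"
      unfolding norm_real_vec d_def
      using sum_mono[of UNIV "\<lambda>j. (real_of_int (fst z $ j))\<^sup>2" "\<lambda>_. t\<^sup>2"]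
        sum_mono[of UNIV "\<lambda>j. (real_of_int (snd z $ j))\<^sup>2" "\<lambda>_. t\<^sup>2"] sq by auto
    let ?T = "1 + \<alpha>\<^sup>2 * (norm (real_vec (fst z)))\<^sup>2 + \<beta>\<^sup>2 * (norm (real_vec (snd z)))\<^sup>2"
    have "?T \<le> 1 + \<alpha>\<^sup>2 * (real d * t\<^sup>2) + \<beta>\<^sup>2 * (real d * t\<^sup>2)"
      by (intro add_mono mult_left_mono norms) auto
    also have "\<dots> \<le> c * (1 + t\<^sup>2)"
      by (simp add: c_def algebra_simps)
    finally have T: "?T \<le> c * (1 + t\<^sup>2)" .
    have "lattice_weight \<alpha> \<beta> s z \<le> ?T powr real N"
      unfolding lattice_weight_def N_def by (intro powr_mono) (auto simp: le_of_int_ceiling real_nat_ceiling_ge)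
    also have "\<dots> = ?T ^ N"
      by (intro powr_realpow) (rule less_le_trans[OF zero_less_one lattice_weight_base_ge])
    also have "\<dots> \<le> (c * (1 + t\<^sup>2)) ^ N"
      by (intro power_mono T) auto
    finally have w: "lattice_weight \<alpha> \<beta> s z \<le> c ^ N * (1 + t\<^sup>2) ^ N"
      by (simp add: power_mult_distrib)
    have "(\<Prod>j\<in>(UNIV :: 'd set). 1 / (1 + t\<^sup>2)) \<le> (\<Prod>j\<in>UNIV. 1 / (1 + (real_of_int (fst z $ j))\<^sup>2))"
      "(\<Prod>j\<in>(UNIV :: 'd set). 1 / (1 + t\<^sup>2)) \<le> (\<Prod>j\<in>UNIV. 1 / (1 + (real_of_int (snd z $ j))\<^sup>2))"
      by (intro prod_mono conjI divide_left_mono add_left_mono sq mult_pos_pos add_pos_nonneg; simp)+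
    then have "(\<Prod>j\<in>(UNIV :: 'd set). 1 / (1 + t\<^sup>2)) * (\<Prod>j\<in>(UNIV :: 'd set). 1 / (1 + t\<^sup>2)) \<le> lattice_decay z"
      unfolding lattice_decay_def by (intro mult_mono prod_nonneg) auto
    then have "1 / (1 + t\<^sup>2) ^ (d + d) \<le> lattice_decay z"
      by (simp add: power_add d_def power_divide)
    then have "1 \<le> (1 + t\<^sup>2) ^ (d + d) * lattice_decay z"
      by (simp add: divide_le_eq add_pos_nonneg mult.commute)
    then have "c ^ N * (1 + t\<^sup>2) ^ N * 1 \<le> c ^ N * (1 + t\<^sup>2) ^ N * ((1 + t\<^sup>2) ^ (d + d) * lattice_decay z)"
      using c by (intro mult_left_mono) auto
    then have w': "lattice_weight \<alpha> \<beta> s z \<le> c ^ N * (1 + t\<^sup>2) ^ n * lattice_decay z"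
      using w by (simp add: n_def power_add mult_ac)
    have "(1 + t\<^sup>2) ^ n \<le> (2 * max 1 (t\<^sup>2)) ^ n"
      by (intro power_mono) auto
    also have "\<dots> = 2 ^ n * max 1 (t\<^sup>2) ^ n"
      by (simp add: power_mult_distrib)
    also have "max 1 (t\<^sup>2) ^ n \<le> 1 + t ^ (2 * n)"
      by (cases "1 \<le> t\<^sup>2") (auto simp: power_mult t0)
    also have "t ^ (2 * n) \<le> (\<Sum>\<phi>\<in>?\<Phi>. real_of_int \<bar>\<phi> z\<bar> ^ (2 * n))"
      unfolding t_def using fin \<psi>(1)
      by (intro member_le_sum[of \<psi> ?\<Phi> "\<lambda>\<phi>. real_of_int \<bar>\<phi> z\<bar> ^ (2 * n)"]) auto
    finally have "(1 + t\<^sup>2) ^ n \<le> 2 ^ n * (1 + (\<Sum>\<phi>\<in>?\<Phi>. real_of_int \<bar>\<phi> z\<bar> ^ (2 * n)))"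
      by simp
    then have "c ^ N * (1 + t\<^sup>2) ^ n * lattice_decay z \<le>
        c ^ N * (2 ^ n * (1 + (\<Sum>\<phi>\<in>?\<Phi>. real_of_int \<bar>\<phi> z\<bar> ^ (2 * n)))) * lattice_decay z"
      using c by (intro mult_right_mono mult_left_mono less_imp_le[OF lattice_decay_pos]) auto
    with w' show ?thesis
      by (simp add: mult_ac)
  qed
  then show ?thesis by blast
qed

text \<open>Each coordinate is at most \<open>(1 / \<alpha> + 1 / \<beta>)\<close> times the square
  root of the weight base, which uses that both lattice constants are positive. Summing over all
  coordinates gives \<open>c\<close>.\<close>

lemma degree_weight_le_lattice_weight:
  assumes "\<alpha> > 0" "\<beta> > 0"
  shows "\<exists>C. \<forall>z :: (int ^ 'd) \<times> (int ^ 'd).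
    (1 + (\<Sum>\<phi>\<in>lattice_coordinates. real_of_int \<bar>\<phi> z\<bar>)) ^ M \<le> C * lattice_weight \<alpha> \<beta> (real M) z"
proof -
  let ?\<Phi> = "lattice_coordinates :: ((int ^ 'd) \<times> (int ^ 'd) \<Rightarrow> int) set"
  define c where "c = 1 + real (card ?\<Phi>) * (1 / \<alpha> + 1 / \<beta>)"
  have "(1 + (\<Sum>\<phi>\<in>?\<Phi>. real_of_int \<bar>\<phi> z\<bar>)) ^ M \<le> c ^ M * lattice_weight \<alpha> \<beta> (real M) z" for z
  proof -
    let ?T = "1 + \<alpha>\<^sup>2 * (norm (real_vec (fst z)))\<^sup>2 + \<beta>\<^sup>2 * (norm (real_vec (snd z)))\<^sup>2"
    have comp: "\<bar>real_of_int (k $ j)\<bar> \<le> norm (real_vec k)" for k :: "int ^ 'd" and j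
      using component_le_norm_cart[of "real_vec k" j] by (simp add: real_vec_def)
    have "\<alpha> * norm (real_vec (fst z)) \<le> sqrt ?T" "\<beta> * norm (real_vec (snd z)) \<le> sqrt ?T"
      by (rule real_le_rsqrt, simp add: power_mult_distrib)+
    then have norms: "norm (real_vec (fst z)) \<le> 1 / \<alpha> * sqrt ?T" "norm (real_vec (snd z)) \<le> 1 / \<beta> * sqrt ?T"
      using assms by (simp_all add: field_simps)
    have "real_of_int \<bar>\<phi> z\<bar> \<le> (1 / \<alpha> + 1 / \<beta>) * sqrt ?T" if "\<phi> \<in> ?\<Phi>" for \<phi>
    proof -
      have "real_of_int \<bar>\<phi> z\<bar> \<le> max (norm (real_vec (fst z))) (norm (real_vec (snd z)))"
        using that comp by (auto simp: lattice_coordinates_def max.coboundedI1 max.coboundedI2)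
      also have "\<dots> \<le> norm (real_vec (fst z)) + norm (real_vec (snd z))"
        by simp
      also have "\<dots> \<le> (1 / \<alpha> + 1 / \<beta>) * sqrt ?T"
        using norms by (simp add: distrib_right)
      finally show ?thesis .
    qed
    then have "(\<Sum>\<phi>\<in>?\<Phi>. real_of_int \<bar>\<phi> z\<bar>) \<le> (\<Sum>\<phi>\<in>?\<Phi>. (1 / \<alpha> + 1 / \<beta>) * sqrt ?T)"
      by (rule sum_mono)
    moreover have "1 \<le> sqrt ?T"
      by simp
    moreover have "c * sqrt ?T = sqrt ?T + (\<Sum>\<phi>\<in>?\<Phi>. (1 / \<alpha> + 1 / \<beta>) * sqrt ?T)"
      by (simp only: c_def distrib_right mult_1_left mult.assoc sum_constant)
    ultimately have "1 + (\<Sum>\<phi>\<in>?\<Phi>. real_of_int \<bar>\<phi> z\<bar>) \<le> c * sqrt ?T"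
      by linarith
    then have "(1 + (\<Sum>\<phi>\<in>?\<Phi>. real_of_int \<bar>\<phi> z\<bar>)) ^ M \<le> (c * sqrt ?T) ^ M"
      by (intro power_mono) (simp_all add: sum_nonneg)
    also have "\<dots> = c ^ M * sqrt ?T ^ M"
      by (simp add: power_mult_distrib)
    also have "sqrt ?T ^ M = lattice_weight \<alpha> \<beta> (real M) z"
    proof -
      have "0 < ?T"
        by (rule less_le_trans[OF zero_less_one lattice_weight_base_ge])
      then have "sqrt ?T ^ M = (?T powr (1 / 2)) powr real M"
        by (simp add: powr_half_sqrt powr_realpow)
      then show ?thesis
        by (simp add: lattice_weight_def powr_powr)
    qed
    finally show ?thesis .
  qed
  then show ?thesis by blast
qed

text \<open>The bridge to the abstract setting: curried double sequences become functions on pairs.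
  In the converse direction complex linearity of the sum is automatic, since the partial sums are
  complex-linear and that property is closed under norm limits.\<close>

lemma mem_tf_algebra_iff:
  fixes A :: "(real ^ 'd) L2_op"
  assumes "0 \<le> s"
  shows "A \<in> tf_algebra s \<alpha> \<beta> \<longleftrightarrow>
    (\<exists>a \<in> wl1 (lattice_weight \<alpha> \<beta> s). A = twisted_rep.op (lattice_shift \<alpha> \<beta>) a)"
proof -
  interpret twisted_rep "lattice_shift \<alpha> \<beta>" "lattice_cocycle \<alpha> \<beta>" "\<lambda>z. lattice_cocycle \<alpha> \<beta> z z"
    by (rule twisted_rep_lattice)
  have weighted: "a \<in> weighted_l1 s \<alpha> \<beta> \<longleftrightarrow> (\<lambda>z. a (fst z) (snd z)) \<in> wl1 (lattice_weight \<alpha> \<beta> s)" for a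
    by (simp add: weighted_l1_def wl1_def lattice_weight_def case_prod_unfold)
  have sum: "(\<lambda>(k, l). cscale_op (a k l) (tf_shift (\<alpha> *\<^sub>R real_vec k) (\<beta> *\<^sub>R real_vec l))) =
      (\<lambda>z. cscale_op (a (fst z) (snd z)) (lattice_shift \<alpha> \<beta> z))" for a
    by (simp add: lattice_shift_def case_prod_unfold)
  have l1: "a \<in> l1" if "a \<in> wl1 (lattice_weight \<alpha> \<beta> s)" for a :: "(int ^ 'd) \<times> (int ^ 'd) \<Rightarrow> complex"
    by (rule wl1_mono[OF that, where C = 1]) (auto simp: lattice_weight_ge_1 assms)
  show ?thesis
  proof
    assume "A \<in> tf_algebra s \<alpha> \<beta>"
    then obtain a where "a \<in> weighted_l1 s \<alpha> \<beta>"
      and "((\<lambda>z. cscale_op (a (fst z) (snd z)) (lattice_shift \<alpha> \<beta> z)) has_sum A) UNIV"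
      unfolding tf_algebra_def sum by blast
    then show "\<exists>a \<in> wl1 (lattice_weight \<alpha> \<beta> s). A = op a"
      unfolding weighted by (intro bexI op_eqI[symmetric])
  next
    assume "\<exists>a \<in> wl1 (lattice_weight \<alpha> \<beta> s). A = op a"
    then obtain a where a: "a \<in> wl1 (lattice_weight \<alpha> \<beta> s)" "A = op a"
      by blast
    have "((\<lambda>z. cscale_op (a (fst z, snd z)) (lattice_shift \<alpha> \<beta> z)) has_sum A) UNIV"
      using has_sum_op[OF l1[OF a(1)]] by (simp add: a(2))
    moreover have "A \<in> bounded_ops"
      unfolding a(2) by (rule op_in_bounded_ops[OF l1[OF a(1)]])
    ultimately show "A \<in> tf_algebra s \<alpha> \<beta>"
      unfolding tf_algebra_def sum using a(1)
      by (intro CollectI conjI bexI[of _ "\<lambda>k l. a (k, l)"]) (simp_all add: weighted)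
  qed
qed

section \<open>Subalgebras, inclusion in the rotation algebra and inverses\<close>

lemma subalgebra_tf_algebra:
  assumes "0 \<le> s"
  shows "subalgebra (tf_algebra s \<alpha> \<beta> :: (real ^ 'd) L2_op set)"
    and "id_blinfun \<in> (tf_algebra s \<alpha> \<beta> :: (real ^ 'd) L2_op set)"
proof -
  interpret twisted_rep "lattice_shift \<alpha> \<beta>" "lattice_cocycle \<alpha> \<beta>" "\<lambda>z. lattice_cocycle \<alpha> \<beta> z z"
    by (rule twisted_rep_lattice)
  let ?W = "wl1 (lattice_weight \<alpha> \<beta> s)"
  have l1: "a \<in> l1" if "a \<in> ?W" for a :: "(int ^ 'd) \<times> (int ^ 'd) \<Rightarrow> complex"
    by (rule wl1_mono[OF that, where C = 1]) (auto simp: lattice_weight_ge_1 assms)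
  have memI: "op a \<in> tf_algebra s \<alpha> \<beta>" if "a \<in> ?W" for a
    unfolding mem_tf_algebra_iff[OF assms] using that by blast
  have "op (\<lambda>z. if z = 0 then 1 else 0) \<in> tf_algebra s \<alpha> \<beta>"
    by (rule memI[OF wl1_delta])
  then show id: "id_blinfun \<in> (tf_algebra s \<alpha> \<beta> :: (real ^ 'd) L2_op set)"
    by (simp add: op_delta u_0)
  have scale: "cscale_op c A \<in> tf_algebra s \<alpha> \<beta>" if "A \<in> tf_algebra s \<alpha> \<beta>" for c and A :: "(real ^ 'd) L2_op"
  proof -
    obtain a where a: "a \<in> ?W" "A = op a"
      using \<open>A \<in> tf_algebra s \<alpha> \<beta>\<close> unfolding mem_tf_algebra_iff[OF assms] by blast
    show ?thesis
      unfolding a(2) op_cmult[OF l1[OF a(1)], symmetric] by (rule memI[OF wl1_cmult[OF a(1)]])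
  qed
  have "A + B \<in> tf_algebra s \<alpha> \<beta>" "A o\<^sub>L B \<in> tf_algebra s \<alpha> \<beta>"
    if "A \<in> tf_algebra s \<alpha> \<beta>" "B \<in> tf_algebra s \<alpha> \<beta>" for A B :: "(real ^ 'd) L2_op"
  proof -
    obtain a b where a: "a \<in> ?W" "A = op a" and b: "b \<in> ?W" "B = op b"
      using \<open>A \<in> tf_algebra s \<alpha> \<beta>\<close> \<open>B \<in> tf_algebra s \<alpha> \<beta>\<close> unfolding mem_tf_algebra_iff[OF assms] by blast
    show "A + B \<in> tf_algebra s \<alpha> \<beta>"
      unfolding a(2) b(2) op_add[OF l1[OF a(1)] l1[OF b(1)], symmetric]
      by (rule memI[OF wl1_add[OF a(1) b(1) lattice_weight_nonneg]])
    show "A o\<^sub>L B \<in> tf_algebra s \<alpha> \<beta>"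
      unfolding a(2) b(2) op_conv[OF l1[OF a(1)] l1[OF b(1)], symmetric]
      by (rule memI[OF conv_wl1[OF a(1) b(1) lattice_weight_nonneg lattice_weight_submult[OF assms]]])
  qed
  moreover have "0 \<in> (tf_algebra s \<alpha> \<beta> :: (real ^ 'd) L2_op set)"
    using scale[OF id, of 0] by (simp add: cscale_op.zero_left)
  ultimately show "subalgebra (tf_algebra s \<alpha> \<beta> :: (real ^ 'd) L2_op set)"
    unfolding subalgebra_def using scale by (auto simp: tf_algebra_def)
qed

lemma subalgebra_INT:
  assumes "I \<noteq> {}" "\<And>i. i \<in> I \<Longrightarrow> subalgebra (S i)"
  shows "subalgebra (\<Inter>i\<in>I. S i)"
  unfolding subalgebra_def
proof (intro conjI allI ballI)
  obtain i where "i \<in> I"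
    using assms(1) by blast
  then have "S i \<subseteq> bounded_ops"
    using assms(2) by (simp add: subalgebra_def)
  then show "(\<Inter>i\<in>I. S i) \<subseteq> bounded_ops"
    using \<open>i \<in> I\<close> by blast
qed (use assms in \<open>auto simp: subalgebra_def\<close>)

lemma subalgebra_noncommutative_torus: "subalgebra (noncommutative_torus \<alpha> \<beta>)"
  unfolding noncommutative_torus_def by (rule subalgebra_INT) (auto intro: subalgebra_tf_algebra)

lemma rotation_algebra:
  "subalgebra (rotation_algebra \<alpha> \<beta> :: (real ^ 'd) L2_op set)"
  "closed (rotation_algebra \<alpha> \<beta> :: (real ^ 'd) L2_op set)"
  "range (lattice_shift \<alpha> \<beta>) \<subseteq> (rotation_algebra \<alpha> \<beta> :: (real ^ 'd) L2_op set)"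
proof -
  let ?S = "{A \<in> bounded_ops :: (real ^ 'd) L2_op set. \<exists>B \<in> bounded_ops. is_adjoint A B}"
  have "tf_shift x \<omega> \<in> ?S" for x \<omega> :: "real ^ 'd"
  proof -
    have "cscale_op c (tf_shift (- x) (- \<omega>)) \<in> bounded_ops" for c
      using subalgebra_bounded_ops tf_shift_in_bounded_ops unfolding subalgebra_def by blast
    then show ?thesis
      using is_adjoint_tf_shift tf_shift_in_bounded_ops by blast
  qed
  then have *: "range (\<lambda>(k, l). tf_shift (\<alpha> *\<^sub>R real_vec k) (\<beta> *\<^sub>R real_vec l)) \<subseteq> ?S"
    by (simp only: image_subset_iff case_prod_unfold) blast
  show "subalgebra (rotation_algebra \<alpha> \<beta> :: (real ^ 'd) L2_op set)"
    and "closed (rotation_algebra \<alpha> \<beta> :: (real ^ 'd) L2_op set)"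
    and "range (lattice_shift \<alpha> \<beta>) \<subseteq> (rotation_algebra \<alpha> \<beta> :: (real ^ 'd) L2_op set)"
    unfolding rotation_algebra_def lattice_shift_def by (rule cstar_generated[OF *])+
qed

lemma noncommutative_torus_subset_rotation_algebra:
  "noncommutative_torus \<alpha> \<beta> \<subseteq> (rotation_algebra \<alpha> \<beta> :: (real ^ 'd) L2_op set)"
proof
  interpret twisted_rep "lattice_shift \<alpha> \<beta>" "lattice_cocycle \<alpha> \<beta>" "\<lambda>z. lattice_cocycle \<alpha> \<beta> z z"
    by (rule twisted_rep_lattice)
  fix A :: "(real ^ 'd) L2_op"
  assume "A \<in> noncommutative_torus \<alpha> \<beta>"
  then have "A \<in> tf_algebra 0 \<alpha> \<beta>"
    by (auto simp: noncommutative_torus_def)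
  then obtain a where a: "a \<in> wl1 (lattice_weight \<alpha> \<beta> 0)" "A = op a"
    unfolding mem_tf_algebra_iff[OF order_refl] by blast
  have "a \<in> l1"
    by (rule wl1_mono[OF a(1), where C = 1]) (auto simp: lattice_weight_ge_1)
  then show "A \<in> rotation_algebra \<alpha> \<beta>"
    unfolding a(2) by (rule op_in_closed_subalgebra[OF _ rotation_algebra])
qed

text \<open>The order \<open>M\<close> of the moments required depends on \<open>s\<close> and the
  dimension, so membership of \<open>A\<close> for exponents beyond \<open>s\<close> is used even
  for a fixed \<open>s\<close>.\<close>

lemma inverse_in_tf_algebra:
  fixes A :: "(real ^ 'd) L2_op"
  assumes pos: "\<alpha> > 0" "\<beta> > 0" and A: "A \<in> noncommutative_torus \<alpha> \<beta>" and s: "0 \<le> s"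
    and inv: "A o\<^sub>L B = id_blinfun" "B o\<^sub>L A = id_blinfun"
  shows "B \<in> tf_algebra s \<alpha> \<beta>"
proof -
  interpret graded_rep "lattice_shift \<alpha> \<beta>" "lattice_cocycle \<alpha> \<beta>" "\<lambda>z. lattice_cocycle \<alpha> \<beta> z z"
    "lattice_coordinates :: ((int ^ 'd) \<times> (int ^ 'd) \<Rightarrow> int) set"
    by (rule graded_rep_lattice[OF pos])
  obtain M K where M: "\<And>z :: (int ^ 'd) \<times> (int ^ 'd). lattice_weight \<alpha> \<beta> s z \<le>
      K * (1 + (\<Sum>\<phi>\<in>lattice_coordinates. real_of_int \<bar>\<phi> z\<bar> ^ M)) * lattice_decay z"
    using lattice_weight_le_coordinates[of \<alpha> \<beta> s] by blast
  \<comment> \<open>Each exponent comes with its own coefficient family. The exponent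
    \<open>s + real M\<close> dominates both \<open>s\<close> and \<open>real M\<close>, so a single
    family \<open>a\<close> lies in both weighted spaces.\<close>
  have "A \<in> tf_algebra (s + real M) \<alpha> \<beta>"
    using A s by (auto simp: noncommutative_torus_def)
  moreover have "0 \<le> s + real M"
    using s by simp
  ultimately obtain a where a: "a \<in> wl1 (lattice_weight \<alpha> \<beta> (s + real M))" "A = op a"
    using mem_tf_algebra_iff by blast
  have as: "a \<in> wl1 (lattice_weight \<alpha> \<beta> s)"
    by (rule wl1_mono[OF a(1), where C = 1]) (auto simp: lattice_weight_nonneg intro: lattice_weight_mono)
  have am: "a \<in> wl1 (lattice_weight \<alpha> \<beta> (real M))"
    by (rule wl1_mono[OF a(1), where C = 1]) (auto simp: lattice_weight_nonneg s intro: lattice_weight_mono)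
  obtain C where C: "\<And>z :: (int ^ 'd) \<times> (int ^ 'd). degree_weight M z \<le> C * lattice_weight \<alpha> \<beta> (real M) z"
    unfolding degree_weight_def using degree_weight_le_lattice_weight[OF pos, of M] by blast
  have aM: "a \<in> wl1 (degree_weight M)"
    by (rule wl1_mono[OF am degree_weight_nonneg C])
  have "\<exists>b \<in> wl1 (lattice_weight \<alpha> \<beta> s). B = op b"
    by (rule inverse_wl1[OF aM as lattice_weight_ge_1[OF s] lattice_weight_minus lattice_weight_submult[OF s]
          lattice_decay_summable less_imp_le[OF lattice_decay_pos] M inv[unfolded a(2)]])
  then show ?thesis
    unfolding mem_tf_algebra_iff[OF s] .
qed

theorem corollary4p12:
  fixes \<alpha> \<beta> :: real
  assumes "\<alpha> > 0" and "\<beta> > 0"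
  shows "spectral_invariant
           (noncommutative_torus \<alpha> \<beta> :: (real ^ 'd::finite) L2_op set)
           (rotation_algebra \<alpha> \<beta>)"
proof -
  have id: "id_blinfun \<in> (noncommutative_torus \<alpha> \<beta> :: (real ^ 'd) L2_op set)"
    by (simp add: noncommutative_torus_def subalgebra_tf_algebra(2))
  have "banach_subalgebra (rotation_algebra \<alpha> \<beta> :: (real ^ 'd) L2_op set)"
    by (simp add: banach_subalgebra_def rotation_algebra(1,2) complete_eq_closed)
  moreover have "B \<in> noncommutative_torus \<alpha> \<beta>"
    if "A \<in> noncommutative_torus \<alpha> \<beta>" "A o\<^sub>L B = id_blinfun \<and> B o\<^sub>L A = id_blinfun"
    for A B :: "(real ^ 'd) L2_op"
    using inverse_in_tf_algebra[OF assms that(1)] that(2) by (simp add: noncommutative_torus_def)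
  ultimately show ?thesis
    unfolding spectral_invariant_def
    using id subalgebra_noncommutative_torus noncommutative_torus_subset_rotation_algebra by blast
qed

end
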